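(* Let $\omega=\{\omega(n)\}_{n\ge 0}$ be any sequence with $0<\omega(n)$ nondecreasing and $\omega(n)\to\infty$. Then there exists a function $f$ in the Wiener algebra $A(\mathbb{T})=\{f:\sum_{n\in\mathbb{Z}}|\widehat f(n)|<\infty\}$ which cannot be written as $f=g+h$ with $g\in\mathrm{PLA}$ and $h\in\mathcal{H}_\omega$. In particular $\mathrm{PLA}+\mathcal{H}_\omega\neq L^0(\mathbb{T})$ and $\mathrm{PLA}+\mathcal{H}_\omega\not\supseteq A(\mathbb{T})$.
   Context: $\mathbb{T}=\mathbb{R}/2\pi\mathbb{Z}$ with Lebesgue measure. $L^0(\mathbb{T})$ is the space of measurable, almost everywhere finite functions on $\mathbb{T}$ (modulo a.e. equality). $\mathrm{PLA}$ denotes the set of measurable functions $g$ on $\mathbb{T}$ for which there exist complex numbers $c(n)$, $n\ge 0$, such that the partial sums $\sum_{0\le n<N}c(n)e^{int}$ converge to $g(t)$ as $N\to\infty$ for almost every $t$. $\mathcal{H}_\omega=\{h\in L^2(\mathbb{T}):\sum_{n\in\mathbb{Z}}|\widehat h(n)|^2\omega(|n|)^2<\infty\}$, where $\widehat h(n)$ are the Fourier coefficients. $\mathrm{PLA}+\mathcal{H}_\omega=\{g+h: g\in\mathrm{PLA},h\in\mathcal{H}_\omega\}$. *)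

theory Defs
  imports "HOL-Analysis.Analysis"
begin

text \<open>The circle T = R/2piZ is modelled by the interval [0, 2pi] with Lebesgue measure;
  functions on T are functions real => complex considered on [0, 2pi], and equality
  in L^0 is equality almost everywhere on [0, 2pi].\<close>

definition circle_measure :: "real measure" where
  "circle_measure = lebesgue_on {0..2*pi}"

definition fourier_coeff :: "(real \<Rightarrow> complex) \<Rightarrow> int \<Rightarrow> complex" where
  "fourier_coeff f n =
     complex_of_real (1 / (2*pi)) *
       integral\<^sup>L circle_measure (\<lambda>t. f t * cis (- (of_int n * t)))"

definition wiener_algebra :: "(real \<Rightarrow> complex) set" where
  "wiener_algebra = {f. integrable circle_measure f \<and>
       (\<lambda>n. norm (fourier_coeff f n)) summable_on (UNIV :: int set)}"

definition PLA :: "(real \<Rightarrow> complex) set" where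
  "PLA = {g. g \<in> borel_measurable circle_measure \<and>
       (\<exists>c :: nat \<Rightarrow> complex. AE t in circle_measure.
          (\<lambda>N. \<Sum>n<N. c n * cis (real n * t)) \<longlonglongrightarrow> g t)}"

definition H_omega :: "(nat \<Rightarrow> real) \<Rightarrow> (real \<Rightarrow> complex) set" where
  "H_omega \<omega> = {h. h \<in> borel_measurable circle_measure \<and>
       integrable circle_measure (\<lambda>t. (norm (h t))\<^sup>2) \<and>
       (\<lambda>n::int. (norm (fourier_coeff h n))\<^sup>2 * (\<omega> (nat \<bar>n\<bar>))\<^sup>2) summable_on UNIV}"

end

theory Submission
  imports Defs "HOL-Complex_Analysis.Conformal_Mappings" "HOL-Real_Asymp.Real_Asymp"
begin

text \<open>
  The function is a lacunary antianalytic series \<open>f t = (\<Sum>k. a k * cis (- n k * t))\<close> with \<open>a k\<close>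
  decreasing and \<open>n k\<close> increasing very fast. Suppose \<open>f = g + h\<close>. For \<open>s = pi / n k\<close> the difference
  \<open>f (t + s) - f t\<close> is \<open>- 2 a k cis (- n k t)\<close> up to an error much smaller than \<open>(a k)\<^sup>2\<close>, and by
  Parseval the decay of the Fourier coefficients of \<open>h\<close> makes \<open>h (t + s) - h t\<close> equally small off a
  set of small measure, provided that \<open>n k\<close> was chosen large in terms of \<open>\<omega>\<close>. Hence
  \<open>cis (n k t) * (g (t + s) - g t) + 2 a k\<close> is tiny on most of the circle. It is the limit of
  analytic polynomials with constant coefficient \<open>2 a k\<close>, whose partial sums are bounded on most of
  the circle by a constant that does not depend on \<open>k\<close>, since those of \<open>g\<close> converge almost
  everywhere. A two-constants argument shows that the constant coefficient of such a polynomial is at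
  most a constant times the square root of its size on the good set, which is impossible for large \<open>k\<close>.
\<close>

subsection \<open>A two-constants estimate for analytic polynomials\<close>

text \<open>For \<open>w = z * cis (-\<tau>)\<close> the denominator is the squared distance from
  \<open>z\<close> to \<open>cis \<tau>\<close>, so the real part of this analytic kernel is the
  Poisson kernel.\<close>

lemma Re_herglotz:
  fixes w :: complex
  assumes "norm w < 1"
  shows "Re ((1 + w) / (1 - w)) = (1 - (norm w)\<^sup>2) / (norm (1 - w))\<^sup>2"
proof -
  have "Re ((1 + w) / (1 - w)) = (Re ((1 + w) * cnj (1 - w))) / (norm (1 - w))\<^sup>2"
    by (subst complex_div_cnj) (simp add: Re_divide_of_real)
  also have "Re ((1 + w) * cnj (1 - w)) = 1 - (norm w)\<^sup>2"
    unfolding cmod_power2 by (simp add: power2_eq_square algebra_simps)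
  finally show ?thesis .
qed

lemma norm_cis_diff_le: "norm (cis a - cis b) \<le> \<bar>a - b\<bar>"
proof -
  have "norm (cis a - cis b) = 2 * \<bar>sin ((a - b) / 2)\<bar>"
    using dist_exp_i_1[of "a - b"]
    by (metis cis_conv_exp cis_mult diff_add_cancel dist_norm left_diff_distrib mult.commute
        mult.right_neutral mult_1 norm_cis norm_mult)
  also have "\<dots> \<le> 2 * \<bar>(a - b) / 2\<bar>"
    by (intro mult_left_mono abs_sin_x_le_abs_x) auto
  finally show ?thesis by simp
qed

text \<open>Passes from angles to a nontangential approach region at \<open>cis t\<close>. The
  aperture 2 is the one under which the Abel estimate is later applied.\<close>

lemma norm_cis_diff_scaled_le:
  assumes "0 \<le> \<rho>" "\<rho> \<le> 1" "\<bar>t - \<theta>\<bar> \<le> 1 - \<rho>"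
  shows "norm (cis t - of_real \<rho> * cis \<theta>) \<le> 2 * (1 - \<rho>)"
proof -
  have "cis t - of_real \<rho> * cis \<theta> = (cis t - cis \<theta>) + of_real (1 - \<rho>) * cis \<theta>"
    by (simp add: algebra_simps)
  also have "norm \<dots> \<le> \<bar>t - \<theta>\<bar> + (1 - \<rho>)"
    using assms by (intro order_trans[OF norm_triangle_ineq] add_mono norm_cis_diff_le)
      (simp only: norm_mult norm_cis norm_of_real, simp)
  finally show ?thesis using assms by simp
qed

text \<open>The real part of \<open>q\<close> is the Poisson integral of the indicator of \<open>U\<close>. Where it is
  smaller than a constant, the arc of length comparable to the distance to the circle is not
  contained in \<open>U\<close>; this sublevel set replaces the usual sawtooth region over the complement of
  \<open>U\<close>.\<close>

lemma herglotz_transform: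
  fixes U :: "real set"
  assumes U: "U \<in> sets lebesgue" "U \<subseteq> {0..2*pi}"
  obtains q where "q holomorphic_on ball 0 1"
    "q 0 = of_real (measure lebesgue U / (2*pi))"
    "\<And>z. norm z < 1 \<Longrightarrow> 0 \<le> Re (q z)"
    "\<And>\<rho> \<theta>. \<lbrakk>0 \<le> \<rho>; \<rho> < 1; \<theta> \<in> {0..2*pi}; Re (q (of_real \<rho> * cis \<theta>)) < 1 / (8*pi)\<rbrakk>
        \<Longrightarrow> \<exists>t \<in> {0..2*pi} - U. \<bar>t - \<theta>\<bar> \<le> 1 - \<rho>"
proof -
  define M where "M = lebesgue_on U"
  have Ulm: "U \<in> lmeasurable"
    by (rule bounded_set_imp_lmeasurable[OF bounded_subset[OF bounded_closed_interval U(2)] U(1)])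
  interpret M: finite_measure M
    unfolding M_def by (rule finite_measure_lebesgue_on[OF Ulm])
  have meas: "f \<in> borel_measurable M" if "continuous_on UNIV f" for f :: "real \<Rightarrow> complex"
    unfolding M_def by (rule continuous_imp_measurable_on_sets_lebesgue[OF continuous_on_subset[OF that subset_UNIV] U(1)])
  define K where "K z \<tau> = (1 + z * cis (-\<tau>)) / (1 - z * cis (-\<tau>))" for z \<tau>
  define q where "q z = of_real (1 / (2*pi)) * (\<integral>\<tau>. K z \<tau> \<partial>M)" for z
  \<comment> \<open>Taylor coefficients of \<open>q\<close>, read off from
    \<open>(1 + w) / (1 - w) = 2 / (1 - w) - 1\<close>; the correction at \<open>n = 0\<close> is
    the final \<open>- 1\<close>.\<close>
  define a where "a n = of_real (1 / (2*pi)) *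
      (\<integral>\<tau>. 2 * cis (-\<tau>) ^ n - (if n = 0 then 1 else 0) \<partial>M)" for n :: nat
  have ne: "1 - z * cis (-\<tau>) \<noteq> 0" if "norm z < 1" for z \<tau>
    using that by (metis eq_iff_diff_eq_0 less_irrefl mult.right_neutral norm_cis norm_mult norm_one)
  have contK: "continuous_on UNIV (K z)" if "norm z < 1" for z
    unfolding K_def using ne[OF that] by (auto intro!: continuous_intros)
  have sums: "(\<lambda>n. (2 * cis (-\<tau>) ^ n - (if n = 0 then 1 else 0)) * z ^ n) sums K z \<tau>"
    if "norm z < 1" for z \<tau>
  proof -
    have "(\<lambda>n. 2 * (z * cis (-\<tau>)) ^ n - (if n = 0 then 1 else 0)) sums (2 * (1 / (1 - z * cis (-\<tau>))) - 1)"
      using that by (intro sums_diff sums_mult geometric_sums sums_single[of 0 "\<lambda>_. 1"])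
         (auto simp: norm_mult)
    moreover have "2 * (1 / (1 - z * cis (-\<tau>))) - 1 = K z \<tau>"
      using ne[OF that, of \<tau>] by (simp add: K_def field_simps)
    moreover have "(\<lambda>n. 2 * (z * cis (-\<tau>)) ^ n - (if n = 0 then 1 else 0)) =
       (\<lambda>n. (2 * cis (-\<tau>) ^ n - (if n = 0 then 1 else 0)) * z ^ n)"
      by (auto simp: power_mult_distrib algebra_simps)
    ultimately show ?thesis by simp
  qed
  have nb: "norm ((2 * cis (-\<tau>) ^ n - (if n = 0 then 1 else 0)) * z ^ n) \<le> 3 * norm z ^ n" for n \<tau> and z::complex
  proof -
    have "norm (2 * cis (-\<tau>) ^ n - (if n = 0 then 1 else 0)) \<le> 2 + 1"
      by (rule order_trans[OF norm_triangle_ineq4]) (auto simp: norm_mult norm_power)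
    then show ?thesis by (simp add: norm_mult norm_power mult_right_mono)
  qed
  have int_term: "integrable M (\<lambda>\<tau>. (2 * cis (-\<tau>) ^ n - (if n = 0 then 1 else 0)) * z ^ n)" for n z
    by (rule M.integrable_const_bound[of _ "3 * norm z ^ n"]) (use nb in \<open>auto intro!: meas continuous_intros\<close>)
  have int1: "integrable M (\<lambda>\<tau>. (2 * cis (-\<tau>) ^ n - (if n = 0 then 1 else 0)))" for n
    using int_term[of n 1] by simp
  \<comment> \<open>Termwise integration, dominated by \<open>3 * norm z ^ n\<close>, exhibits
    \<open>q\<close> as a power series, which yields holomorphy in the disc.\<close>
  have qsums: "(\<lambda>n. a n * z ^ n) sums q z" if z: "norm z < 1" for z
  proof -
    have "(\<lambda>n. \<integral>\<tau>. (2 * cis (-\<tau>) ^ n - (if n = 0 then 1 else 0)) * z ^ n \<partial>M) sums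
        (\<integral>\<tau>. (\<Sum>n. (2 * cis (-\<tau>) ^ n - (if n = 0 then 1 else 0)) * z ^ n) \<partial>M)"
    proof (rule sums_integral[OF int_term])
      have sg: "summable (\<lambda>n. 3 * norm z ^ n)"
        using z by (intro summable_mult summable_geometric) auto
      show "AE \<tau> in M. summable (\<lambda>n. norm ((2 * cis (-\<tau>) ^ n - (if n = 0 then 1 else 0)) * z ^ n))"
        by (intro AE_I2 summable_comparison_test'[OF sg, of 0]) (use nb in auto)
      show "summable (\<lambda>n. \<integral>\<tau>. norm ((2 * cis (-\<tau>) ^ n - (if n = 0 then 1 else 0)) * z ^ n) \<partial>M)"
      proof (rule summable_comparison_test'[OF summable_mult[OF sg, of "measure M (space M)"], of 0])
        fix n :: nat
        have "(\<integral>\<tau>. norm ((2 * cis (-\<tau>) ^ n - (if n = 0 then 1 else 0)) * z ^ n) \<partial>M) \<le> (\<integral>\<tau>. 3 * norm z ^ n \<partial>M)"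
          by (intro integral_mono integrable_norm int_term M.integrable_const nb)
        then show "norm (\<integral>\<tau>. norm ((2 * cis (-\<tau>) ^ n - (if n = 0 then 1 else 0)) * z ^ n) \<partial>M)
            \<le> measure M (space M) * (3 * norm z ^ n)"
          by (simp add: integral_nonneg_AE)
      qed
    qed
    moreover have "(\<integral>\<tau>. (\<Sum>n. (2 * cis (-\<tau>) ^ n - (if n = 0 then 1 else 0)) * z ^ n) \<partial>M) = (\<integral>\<tau>. K z \<tau> \<partial>M)"
      using sums[OF z] by (simp add: sums_iff)
    ultimately have "(\<lambda>n. of_real (1 / (2*pi)) * (\<integral>\<tau>. (2 * cis (-\<tau>) ^ n - (if n = 0 then 1 else 0)) * z ^ n \<partial>M)) sums q z"
      unfolding q_def by (intro sums_mult) simp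
    then show ?thesis
      using int1 by (simp add: a_def mult.assoc)
  qed
  have intK: "integrable M (K z)" if z: "norm z < 1" for z
  proof (rule M.integrable_const_bound[of _ "2 / (1 - norm z)"])
    have "norm (K z \<tau>) \<le> 2 / (1 - norm z)" for \<tau>
    proof -
      have "norm (1 + z * cis (-\<tau>)) \<le> 2"
        using z norm_triangle_ineq[of 1 "z * cis (-\<tau>)"] by (simp add: norm_mult)
      moreover have "1 - norm z \<le> norm (1 - z * cis (-\<tau>))"
        using norm_triangle_ineq2[of 1 "z * cis (-\<tau>)"] by (simp add: norm_mult)
      ultimately show ?thesis
        unfolding K_def norm_divide using z by (intro frac_le) auto
    qed
    then show "AE \<tau> in M. norm (K z \<tau>) \<le> 2 / (1 - norm z)" by simp
  qed (use contK[OF z] meas in auto)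
  have Req: "Re (q z) = (1 / (2*pi)) * (\<integral>\<tau>. Re (K z \<tau>) \<partial>M)" if "norm z < 1" for z
    unfolding q_def using intK[OF that] by (simp add: integral_Re)
  have ReK: "Re (K z \<tau>) = (1 - (norm z)\<^sup>2) / (norm (1 - z * cis (-\<tau>)))\<^sup>2" if "norm z < 1" for z \<tau>
    unfolding K_def using that by (subst Re_herglotz) (auto simp: norm_mult)
  have ReK0: "0 \<le> Re (K z \<tau>)" if "norm z < 1" for z \<tau>
    unfolding ReK[OF that] using that by (simp add: power_le_one)
  show thesis
  proof
    show "q holomorphic_on ball 0 1"
      by (rule power_series_holomorphic[of _ _ a]) (use qsums in auto)
    show "q 0 = of_real (measure lebesgue U / (2*pi))"
      using U(1) by (simp add: q_def K_def M_def measure_restrict_space scaleR_conv_of_real)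
    show "0 \<le> Re (q z)" if "norm z < 1" for z
      unfolding Req[OF that] using ReK0[OF that] by (intro mult_nonneg_nonneg integral_nonneg_AE) auto
    show "\<exists>t \<in> {0..2*pi} - U. \<bar>t - \<theta>\<bar> \<le> 1 - \<rho>"
      if \<rho>: "0 \<le> \<rho>" "\<rho> < 1" and \<theta>: "\<theta> \<in> {0..2*pi}" and small: "Re (q (of_real \<rho> * cis \<theta>)) < 1 / (8*pi)" for \<rho> \<theta>
    proof (rule ccontr)
      assume neg: "\<not> ?thesis"
      define y where "y = 1 - \<rho>"
      have y: "0 < y" "y \<le> 1" using \<rho> by (auto simp: y_def)
      \<comment> \<open>The circle is cut at 0, so the arc is one-sided: it starts or ends at
        \<open>\<theta>\<close>, on the side that has room for length
        \<open>y \<le> 1\<close>.\<close>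
      obtain u where u: "{u..u+y} \<subseteq> {0..2*pi}" "\<And>t. t \<in> {u..u+y} \<Longrightarrow> \<bar>t - \<theta>\<bar> \<le> y"
      proof (cases "\<theta> \<le> pi")
        case True
        with that[of \<theta>] \<theta> y pi_gt3 show thesis by auto
      next
        case False
        with that[of "\<theta> - y"] \<theta> y pi_gt3 show thesis by auto
      qed
      have sub: "{u..u+y} \<subseteq> U"
      proof
        fix x assume "x \<in> {u..u+y}"
        then show "x \<in> U" using neg u(1) u(2)[of x] unfolding y_def by blast
      qed
      define z where "z = of_real \<rho> * cis \<theta>"
      have nz: "norm z = \<rho>" using \<rho> by (simp add: z_def norm_mult)
      have z1: "norm z < 1" using nz \<rho> by simp
      \<comment> \<open>On the arc the Poisson kernel has numerator at least \<open>y\<close> and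
        denominator at most \<open>(2*y)\<^sup>2\<close>. Integrating over length \<open>y\<close>
        gives 1/4, and the normalization by \<open>2*pi\<close> produces the threshold
        \<open>1 / (8*pi)\<close>.\<close>
      have low: "1 / (4*y) * indicator {u..u+y} \<tau> \<le> Re (K z \<tau>)" for \<tau>
      proof (cases "\<tau> \<in> {u..u+y}")
        case False then show ?thesis using ReK0[OF z1] by simp
      next
        case True
        have "norm (1 - z * cis (-\<tau>)) = norm (cis \<tau> * (1 - z * cis (-\<tau>)))"
          by (simp add: norm_mult)
        also have "cis \<tau> * (1 - z * cis (-\<tau>)) = cis \<tau> - z"
          by (simp add: right_diff_distrib cis_mult mult.left_commute[of "cis \<tau>"])
        also have "norm \<dots> \<le> 2 * y"
          unfolding z_def y_def using \<rho> u(2)[OF True] by (intro norm_cis_diff_scaled_le) (auto simp: y_def)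
        finally have "(norm (1 - z * cis (-\<tau>)))\<^sup>2 \<le> (2*y)\<^sup>2"
          by (intro power_mono) auto
        moreover have "y \<le> 1 - (norm z)\<^sup>2"
        proof -
          have "\<rho>\<^sup>2 \<le> \<rho>" using \<rho> by (simp add: power2_eq_square mult_left_le_one_le)
          then show ?thesis by (simp add: nz y_def)
        qed
        ultimately have "y / (2*y)\<^sup>2 \<le> Re (K z \<tau>)"
          unfolding ReK[OF z1] using y ne[OF z1, of \<tau>] by (intro frac_le) auto
        moreover have "y / (2*y)\<^sup>2 = 1 / (4*y)" using y by (simp add: power2_eq_square)
        ultimately show ?thesis using True by simp
      qed
      have "1/4 = (\<integral>\<tau>. 1 / (4*y) * indicator {u..u+y} \<tau> \<partial>M)"
      proof -
        have "(\<integral>\<tau>. 1 / (4*y) * indicator {u..u+y} \<tau> \<partial>M) = 1 / (4*y) * measure M {u..u+y}"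
          using sub U(1) by (simp add: M_def sets_restrict_space_iff Int_absorb2)
        also have "measure M {u..u+y} = y"
          unfolding M_def using y sub U(1) by (subst measure_restrict_space) auto
        finally show ?thesis using y by simp
      qed
      also have "\<dots> \<le> (\<integral>\<tau>. Re (K z \<tau>) \<partial>M)"
      proof (rule integral_mono)
        show "integrable M (\<lambda>\<tau>. 1 / (4*y) * indicator {u..u+y} \<tau>)"
          using sub U(1) by (intro integrable_mult_right M.integrable_const_bound[of _ 1] borel_measurable_indicator)
             (auto simp: M_def sets_restrict_space_iff indicator_def)
      qed (use low intK[OF z1] in auto)
      finally have "1 / (8*pi) \<le> Re (q z)"
        unfolding Req[OF z1] by (simp add: field_simps)
      then show False using small by (simp add: z_def)
    qed
  qed
qed


text \<open>Abel summation carries a bound on partial sums at a boundary point into a nontangential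
  region there, where \<open>norm (1 - w) / (1 - norm w)\<close> stays bounded. The result does not
  depend on \<open>N\<close>.\<close>

lemma norm_Abel_sum_le:
  fixes b :: "nat \<Rightarrow> complex"
  assumes S: "\<And>m. m \<le> N \<Longrightarrow> norm (\<Sum>n<m. b n) \<le> M" and w: "norm w < 1"
  shows "norm (\<Sum>n<N. b n * w ^ n) \<le> M * (norm (1 - w) / (1 - norm w) + 1)"
proof -
  have M: "0 \<le> M" using S[of 0] by simp
  have Abel: "(\<Sum>n<m. b n * w ^ n) = (1 - w) * (\<Sum>n<m. (\<Sum>i<Suc n. b i) * w ^ n) + (\<Sum>n<m. b n) * w ^ m" for m
    by (induction m) (auto simp: algebra_simps)
  have "norm (\<Sum>n<N. b n * w ^ n) \<le>
      norm (1 - w) * norm (\<Sum>n<N. (\<Sum>i<Suc n. b i) * w ^ n) + norm (\<Sum>n<N. b n) * norm w ^ N"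
    unfolding Abel[of N] norm_mult[symmetric] norm_power[symmetric] by (rule norm_triangle_ineq)
  also have "\<dots> \<le> norm (1 - w) * (M * (1 / (1 - norm w))) + M * 1"
  proof (intro add_mono mult_mono)
    have "norm (\<Sum>n<N. (\<Sum>i<Suc n. b i) * w ^ n) \<le> (\<Sum>n<N. M * norm w ^ n)"
    proof (rule sum_norm_le)
      fix n assume "n \<in> {..<N}"
      then show "norm ((\<Sum>i<Suc n. b i) * w ^ n) \<le> M * norm w ^ n"
        unfolding norm_mult norm_power using S[of "Suc n"] by (intro mult_right_mono) auto
    qed
    also have "\<dots> = M * ((1 - norm w ^ N) / (1 - norm w))"
      using w by (simp add: sum_distrib_left[symmetric] sum_gp_strict)
    also have "\<dots> \<le> M * (1 / (1 - norm w))"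
      using w M by (intro mult_left_mono divide_right_mono) auto
    finally show "norm (\<Sum>n<N. (\<Sum>i<Suc n. b i) * w ^ n) \<le> M * (1 / (1 - norm w))" .
  qed (use S w M power_le_one[of "norm w" N] in auto)
  finally show ?thesis by (simp add: algebra_simps)
qed

text \<open>The maximum principle is applied to \<open>P exp (- (L/\<kappa>) q)\<close> on \<open>{Re q < \<kappa>}\<close>, where
  \<open>exp (-L) = \<eta>\<close>. On the inner part of the boundary the exponential gains the factor \<open>\<eta>\<close>; near
  the circle the polynomial \<open>P\<close> itself is of size \<open>\<eta>\<close>; at the origin the exponential costs at most
  \<open>sqrt \<eta>\<close>.\<close>

lemma norm_constant_coeff_le:
  fixes c :: "nat \<Rightarrow> complex"
  assumes G: "G \<in> sets lebesgue" "G \<subseteq> {0..2*pi}" "measure lebesgue ({0..2*pi} - G) \<le> 1/12"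
    and bounded: "\<And>t m. \<lbrakk>t \<in> G; m \<le> N\<rbrakk> \<Longrightarrow> norm (\<Sum>n<m. c n * cis (real n * t)) \<le> M"
    and small: "\<And>t. t \<in> G \<Longrightarrow> norm (\<Sum>n<N. c n * cis (real n * t)) \<le> \<eta>"
    and \<eta>: "0 < \<eta>" "\<eta> \<le> 1" and M: "1 \<le> M" and N: "0 < N"
  shows "norm (c 0) \<le> 3 * M * sqrt \<eta>"
proof -
  define U where "U = {0..2*pi} - G"
  have U: "U \<in> sets lebesgue" "U \<subseteq> {0..2*pi}" and GU: "{0..2*pi} - U = G"
    using G by (auto simp: U_def)
  obtain q where holq: "q holomorphic_on ball 0 1"
    and q0: "q 0 = of_real (measure lebesgue U / (2*pi))"
    and q_nonneg: "\<And>z. norm z < 1 \<Longrightarrow> 0 \<le> Re (q z)"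
    and near: "\<And>\<rho> \<theta>. \<lbrakk>0 \<le> \<rho>; \<rho> < 1; \<theta> \<in> {0..2*pi}; Re (q (of_real \<rho> * cis \<theta>)) < 1 / (8*pi)\<rbrakk>
        \<Longrightarrow> \<exists>t \<in> G. \<bar>t - \<theta>\<bar> \<le> 1 - \<rho>"
    using herglotz_transform[OF U] unfolding GU by blast
  define P where "P z = (\<Sum>n<N. c n * z ^ n)" for z
  have P_cis: "P (cis t) = (\<Sum>n<N. c n * cis (real n * t))" for t
    unfolding P_def by (intro sum.cong refl) (simp add: Complex.DeMoivre)
  have near_z: "\<exists>t \<in> G. norm (cis t - z) \<le> 2 * (1 - norm z)"
    if "norm z < 1" "Re (q z) < 1 / (8*pi)" for z
  proof -
    have eq: "z = of_real (norm z) * cis (Arg2pi z)"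
      unfolding cis_conv_exp by (metis Arg2pi_eq mult.commute)
    have "Arg2pi z \<in> {0..2*pi}"
      using Arg2pi_ge_0[of z] Arg2pi_lt_2pi[of z] by simp
    then obtain t where "t \<in> G" "\<bar>t - Arg2pi z\<bar> \<le> 1 - norm z"
      using near[of "norm z" "Arg2pi z"] \<open>norm z < 1\<close> \<open>Re (q z) < 1 / (8*pi)\<close>
      unfolding eq[symmetric] by auto
    then show ?thesis
      using norm_cis_diff_scaled_le[of "norm z" t "Arg2pi z"] that unfolding eq[symmetric] by auto
  qed
  have P3M: "norm (P z) \<le> 3 * M" if z: "norm z < 1" "Re (q z) < 1 / (8*pi)" for z
  proof -
    obtain t where t: "t \<in> G" "norm (cis t - z) \<le> 2 * (1 - norm z)"
      using near_z[OF z] by blast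
    \<comment> \<open>Rotating \<open>cis t\<close> to 1 turns the terms of the series at
      \<open>t\<close> into the coefficients of an Abel sum at \<open>w\<close>.\<close>
    define w where "w = z * cis (-t)"
    have "norm (1 - w) = norm (cis t * (1 - w))" by (simp add: norm_mult)
    also have "cis t * (1 - w) = cis t - z"
      by (simp add: w_def right_diff_distrib cis_mult mult.left_commute[of "cis t"])
    finally have w: "norm (1 - w) \<le> 2 * (1 - norm w)" "norm w < 1"
      using t z by (auto simp: w_def norm_mult)
    have "P z = (\<Sum>n<N. (c n * cis (real n * t)) * w ^ n)"
      unfolding P_def w_def
      by (intro sum.cong refl) (simp add: power_mult_distrib Complex.DeMoivre cis_mult)
    also have "norm \<dots> \<le> M * (norm (1 - w) / (1 - norm w) + 1)"
      using w bounded[OF t(1)] by (intro norm_Abel_sum_le) auto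
    also have "\<dots> \<le> M * (2 + 1)"
      using w M by (intro mult_left_mono add_mono) (auto simp: field_simps)
    finally show ?thesis by simp
  qed
  have "continuous_on (cball 0 1) P"
    unfolding P_def by (intro continuous_intros)
  then have "uniformly_continuous_on (cball 0 1) P"
    by (rule compact_uniformly_continuous) simp
  then obtain \<delta> where \<delta>: "0 < \<delta>"
    "\<And>x y. \<lbrakk>norm x \<le> 1; norm y \<le> 1; norm (y - x) < \<delta>\<rbrakk> \<Longrightarrow> norm (P y - P x) < 2 * \<eta>"
    using \<eta>(1) uniformly_continuous_onE[of "cball 0 1" P "2 * \<eta>"] by (auto simp: dist_norm)
  \<comment> \<open>The circle of radius \<open>\<rho>\<close> is so close to the unit circle that
    uniform continuity transfers smallness of \<open>P\<close> from \<open>G\<close>: the distance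
    in \<open>near_z\<close> becomes at most \<open>2 * \<delta> / 3\<close>.\<close>
  define \<rho> where "\<rho> = max (1/2) (1 - \<delta>/3)"
  have \<rho>: "0 < \<rho>" "\<rho> < 1" "2 * (1 - \<rho>) < \<delta>"
    using \<delta>(1) by (auto simp: \<rho>_def max_def field_simps)
  \<comment> \<open>Below \<open>1 / (8*pi)\<close>, so that \<open>near_z\<close> still holds where
    \<open>Re (q z) = \<kappa>\<close>; and twice the bound \<open>1 / (24*pi)\<close> on
    \<open>Re (q 0)\<close> that measure 1/12 gives, so the loss at the origin is only
    \<open>exp (- L / 2)\<close>.\<close>
  define \<kappa> where "\<kappa> = 1 / (12*pi)"
  have \<kappa>: "0 < \<kappa>" "\<kappa> < 1 / (8*pi)" by (auto simp: \<kappa>_def field_simps)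
  define L where "L = ln (1/\<eta>)"
  have L: "0 \<le> L" "exp (- L) = \<eta>"
    using \<eta> by (auto simp: L_def ln_div)
  define \<Phi> where "\<Phi> z = P z * exp (- (of_real (L / \<kappa>) * q z))" for z
  \<comment> \<open>Stopping at radius \<open>\<rho> < 1\<close> keeps the closure inside the disc
    where \<open>q\<close> is holomorphic.\<close>
  define S where "S = ball 0 \<rho> \<inter> (Re \<circ> q) -` {..<\<kappa>}"
  have sub: "cball 0 \<rho> \<subseteq> ball (0::complex) 1" using \<rho> by auto
  have contq: "continuous_on (ball 0 1) q"
    using holq by (rule holomorphic_on_imp_continuous_on)
  have contRe: "continuous_on (cball 0 \<rho>) (Re \<circ> q)"
    by (intro continuous_on_compose continuous_on_subset[OF contq sub] continuous_intros)
  have opS: "open S" unfolding S_def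
    by (intro continuous_open_preimage continuous_on_subset[OF contRe]) auto
  have clS: "closure S \<subseteq> cball 0 \<rho> \<inter> (Re \<circ> q) -` {..\<kappa>}"
    by (intro closure_minimal continuous_closed_preimage contRe) (auto simp: S_def)
  have norm\<Phi>: "norm (\<Phi> z) = norm (P z) * exp (- (L / \<kappa> * Re (q z)))" for z
    by (simp add: \<Phi>_def norm_mult)
  have "norm (\<Phi> 0) \<le> 3 * M * \<eta>"
  proof (rule maximum_modulus_frontier[where f = \<Phi> and S = S and \<xi> = 0])
    have hol: "\<Phi> holomorphic_on ball 0 1"
      unfolding \<Phi>_def P_def by (intro holomorphic_intros holq)
    show "\<Phi> holomorphic_on interior S"
      by (rule holomorphic_on_subset[OF hol]) (use interior_subset[of S] \<rho> in \<open>auto simp: S_def\<close>)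
    show "continuous_on (closure S) \<Phi>"
      using holomorphic_on_imp_continuous_on[OF hol] by (rule continuous_on_subset) (use clS sub in auto)
    show "bounded S" unfolding S_def by (intro bounded_Int) auto
    have "Re (q 0) < \<kappa>"
      using G(3) by (simp add: q0 \<kappa>_def U_def field_simps)
    then show "0 \<in> S" using \<rho> by (simp add: S_def)
    fix z assume "z \<in> frontier S"
    then have z: "norm z \<le> \<rho>" "Re (q z) \<le> \<kappa>" and "z \<notin> S"
      using clS opS by (auto simp: frontier_def interior_open)
    then consider "norm z = \<rho>" | "Re (q z) = \<kappa>"
      by (force simp: S_def)
    then show "norm (\<Phi> z) \<le> 3 * M * \<eta>"
    proof cases
      case 1
      obtain t where t: "t \<in> G" "norm (cis t - z) \<le> 2 * (1 - norm z)"
        using near_z[of z] z \<kappa> \<rho> by force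
      then have "norm (P z - P (cis t)) < 2 * \<eta>"
        using 1 \<rho> z by (intro \<delta>(2)) (auto simp: norm_minus_commute)
      moreover have "norm (P (cis t)) \<le> \<eta>"
        using small[OF t(1)] by (simp add: P_cis)
      ultimately have "norm (P z) \<le> 3 * \<eta>"
        using norm_triangle_ineq2[of "P z" "P (cis t)"] by linarith
      moreover have "exp (- (L / \<kappa> * Re (q z))) \<le> 1"
        using L \<kappa> q_nonneg[of z] z \<rho> by simp
      ultimately have "norm (\<Phi> z) \<le> 3 * \<eta> * 1"
        unfolding norm\<Phi> using \<eta> by (intro mult_mono) auto
      also have "\<dots> \<le> 3 * M * \<eta>" using M \<eta> by simp
      finally show ?thesis .
    next
      case 2
      then have "norm (\<Phi> z) = norm (P z) * \<eta>"
        unfolding norm\<Phi> using \<kappa> L by simp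
      then show ?thesis
        using P3M[of z] z \<rho> \<kappa> \<eta> by (simp add: mult_right_mono)
    qed
  qed
  moreover have "norm (\<Phi> 0) \<ge> norm (c 0) * sqrt \<eta>"
  proof -
    have "P 0 = (\<Sum>n\<in>{0}. c n * 0 ^ n)"
      unfolding P_def using N by (intro sum.mono_neutral_right) auto
    then have "P 0 = c 0" by simp
    moreover have "sqrt \<eta> \<le> exp (- (L / \<kappa> * Re (q 0)))"
    proof -
      have "sqrt \<eta> = exp (- L / 2)"
        using \<eta> by (simp add: L_def ln_div powr_half_sqrt[symmetric] powr_def)
      moreover have "L / \<kappa> * Re (q 0) \<le> L / 2"
      proof -
        have "Re (q 0) / \<kappa> \<le> 1/2" using G(3) by (simp add: q0 \<kappa>_def U_def field_simps)
        from mult_left_mono[OF this L(1)] show ?thesis by simp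
      qed
      ultimately show ?thesis by simp
    qed
    ultimately show ?thesis unfolding norm\<Phi> by (simp add: mult_left_mono)
  qed
  ultimately have "norm (c 0) * sqrt \<eta> \<le> 3 * M * \<eta>" by simp
  also have "3 * M * \<eta> = (3 * M * sqrt \<eta>) * sqrt \<eta>" using \<eta> by simp
  finally show ?thesis using \<eta> by simp
qed

subsection \<open>Parseval inequality on the circle\<close>

lemma circle_measure_finite: "finite_measure circle_measure"
  unfolding circle_measure_def by (rule finite_measure_lebesgue_on) simp

interpretation circle: finite_measure circle_measure
  by (rule circle_measure_finite)

lemma space_circle_measure [simp]: "space circle_measure = {0..2*pi}"
  by (simp add: circle_measure_def)

lemma measure_circle_measure: "A \<subseteq> {0..2*pi} \<Longrightarrow> measure circle_measure A = measure lebesgue A"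
  by (simp add: circle_measure_def measure_restrict_space)

lemma borel_measurable_circle_continuous:
  "continuous_on UNIV f \<Longrightarrow> f \<in> borel_measurable circle_measure"
  unfolding circle_measure_def
  by (rule continuous_imp_measurable_on_sets_lebesgue) (auto intro: continuous_on_subset)

lemma measurable_cis_circle [measurable]: "(\<lambda>t. cis (a * t)) \<in> borel_measurable circle_measure"
  by (intro borel_measurable_circle_continuous continuous_intros)

lemma integrable_circle_mult_bounded:
  fixes f g :: "real \<Rightarrow> complex"
  assumes "integrable circle_measure f" "g \<in> borel_measurable circle_measure"
    and "\<And>t. t \<in> {0..2*pi} \<Longrightarrow> norm (g t) \<le> B"
  shows "integrable circle_measure (\<lambda>t. f t * g t)"
proof (rule Bochner_Integration.integrable_bound)
  show "integrable circle_measure (\<lambda>t. B * norm (f t))"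
    using assms(1) by simp
  show "AE t in circle_measure. norm (f t * g t) \<le> norm (B * norm (f t))"
  proof (rule AE_I2)
    fix t assume "t \<in> space circle_measure"
    then have "norm (g t) \<le> B" using assms(3) by simp
    then have "norm (f t) * norm (g t) \<le> norm (f t) * \<bar>B\<bar>" by (intro mult_left_mono) auto
    then show "norm (f t * g t) \<le> norm (B * norm (f t))" by (simp add: norm_mult abs_mult mult.commute)
  qed
qed (use assms in measurable)

lemma integrable_circle_of_square_integrable:
  fixes f :: "real \<Rightarrow> complex"
  assumes "f \<in> borel_measurable circle_measure" "integrable circle_measure (\<lambda>t. (norm (f t))\<^sup>2)"
  shows "integrable circle_measure f"
proof (rule Bochner_Integration.integrable_bound[of _ "\<lambda>t. 1 + (norm (f t))\<^sup>2"])
  have "x \<le> 1 + x\<^sup>2" for x :: real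
    using zero_le_power2[of "x - 1/2"] by (simp add: power2_eq_square algebra_simps)
  then show "AE t in circle_measure. norm (f t) \<le> norm (1 + (norm (f t))\<^sup>2)"
    by (intro AE_I2) (simp add: add_nonneg_nonneg)
qed (use assms in auto)

lemma integrable_cis_circle: "integrable circle_measure (\<lambda>t. cis (a * t))"
  by (rule circle.integrable_const_bound[of _ 1]) auto

lemma integral_cis_circle:
  "integral\<^sup>L circle_measure (\<lambda>t. cis (of_int n * t)) = (if n = 0 then of_real (2*pi) else 0)"
proof (cases "n = 0")
  case True
  then show ?thesis by (simp add: measure_circle_measure scaleR_conv_of_real)
next
  case False
  have "((\<lambda>t. cis (of_int n * t)) has_integral
      (- \<i> / of_int n * cis (of_int n * (2*pi)) - - \<i> / of_int n * cis (of_int n * 0))) {0..2*pi}"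
    using False
    by (intro fundamental_theorem_of_calculus)
      (auto simp: has_vector_derivative_def scaleR_conv_of_real mult.left_commute[of \<i> "complex_of_real _"]
        intro!: derivative_eq_intros ext)
  moreover have "cis (of_int n * (2*pi)) = 1"
    using cis_multiple_2pi[of "of_int n"] by (simp add: mult.commute)
  ultimately have "((\<lambda>t. cis (of_int n * t)) has_integral 0) {0..2*pi}" by simp
  then show ?thesis
    using False integrable_cis_circle[of "of_int n"]
    by (simp add: circle_measure_def lebesgue_integral_eq_integral integral_unique)
qed

lemma integrable_fourier_circle:
  "integrable circle_measure f \<Longrightarrow> integrable circle_measure (\<lambda>t. f t * cis (a * t))"
  by (rule integrable_circle_mult_bounded[of _ _ 1]) auto

lemma integral_eq_fourier_coeff:
  "integral\<^sup>L circle_measure (\<lambda>t. f t * cis (- (of_int n * t))) = of_real (2*pi) * fourier_coeff f n"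
  by (simp add: fourier_coeff_def)

lemma fourier_coeff_cis:
  "fourier_coeff (\<lambda>t. cis (of_int m * t)) n = (if m = n then 1 else 0)"
proof -
  have "(\<lambda>t. cis (of_int m * t) * cis (- (of_int n * t))) = (\<lambda>t. cis (of_int (m - n) * t))"
    by (simp add: cis_mult algebra_simps)
  then show ?thesis
    unfolding fourier_coeff_def by (simp only: integral_cis_circle) simp
qed

lemma fourier_coeff_mult_left: "fourier_coeff (\<lambda>t. a * f t) n = a * fourier_coeff f n"
  by (simp add: fourier_coeff_def mult.assoc)

lemma fourier_coeff_diff:
  assumes "integrable circle_measure f" "integrable circle_measure g"
  shows "fourier_coeff (\<lambda>t. f t - g t) n = fourier_coeff f n - fourier_coeff g n"
  using integrable_fourier_circle[OF assms(1), of "- of_int n"] integrable_fourier_circle[OF assms(2), of "- of_int n"]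
  by (simp add: fourier_coeff_def left_diff_distrib right_diff_distrib)

lemma fourier_coeff_sum:
  assumes "\<And>i. i \<in> I \<Longrightarrow> integrable circle_measure (f i)"
  shows "fourier_coeff (\<lambda>t. \<Sum>i\<in>I. f i t) n = (\<Sum>i\<in>I. fourier_coeff (f i) n)"
  using integrable_fourier_circle[OF assms, of _ "- of_int n"]
  by (simp add: fourier_coeff_def sum_distrib_left sum_distrib_right)

section \<open>Trigonometric polynomials\<close>

definition trig_poly :: "(real \<Rightarrow> complex) \<Rightarrow> bool" where
  "trig_poly T \<longleftrightarrow> (\<exists>A c. finite A \<and> T = (\<lambda>t. \<Sum>n\<in>A. c n * cis (of_int n * t)))"

lemma trig_poly_monomial: "trig_poly (\<lambda>t. a * cis (of_int n * t))"
  unfolding trig_poly_def by (rule exI[of _ "{n}"], rule exI[of _ "\<lambda>_. a"]) simp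

lemma trig_poly_const: "trig_poly (\<lambda>t. a)"
  using trig_poly_monomial[of a 0] by simp

lemma trig_poly_add:
  assumes "trig_poly S" "trig_poly T"
  shows "trig_poly (\<lambda>t. S t + T t)"
proof -
  obtain A c B d where A: "finite A" "S = (\<lambda>t. \<Sum>n\<in>A. c n * cis (of_int n * t))"
    and B: "finite B" "T = (\<lambda>t. \<Sum>n\<in>B. d n * cis (of_int n * t))"
    using assms unfolding trig_poly_def by blast
  define e where "e n = (if n \<in> A then c n else 0) + (if n \<in> B then d n else 0)" for n
  have "S t + T t = (\<Sum>n\<in>A \<union> B. e n * cis (of_int n * t))" for t
  proof -
    have "S t = (\<Sum>n\<in>A \<union> B. (if n \<in> A then c n else 0) * cis (of_int n * t))"
      unfolding A(2) using A(1) B(1) by (intro sum.mono_neutral_cong_left) auto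
    moreover have "T t = (\<Sum>n\<in>A \<union> B. (if n \<in> B then d n else 0) * cis (of_int n * t))"
      unfolding B(2) using A(1) B(1) by (intro sum.mono_neutral_cong_left) auto
    ultimately show ?thesis by (simp add: e_def distrib_right sum.distrib)
  qed
  then show ?thesis
    using A(1) B(1) unfolding trig_poly_def by (intro exI[of _ "A \<union> B"] exI[of _ e]) auto
qed

lemma trig_poly_sum: "(\<And>i. i \<in> I \<Longrightarrow> trig_poly (T i)) \<Longrightarrow> trig_poly (\<lambda>t. \<Sum>i\<in>I. T i t)"
  by (induction I rule: infinite_finite_induct) (auto intro: trig_poly_add trig_poly_const)

lemma trig_poly_mult:
  assumes "trig_poly S" "trig_poly T"
  shows "trig_poly (\<lambda>t. S t * T t)"
proof -
  obtain A c B d where A: "S = (\<lambda>t. \<Sum>n\<in>A. c n * cis (of_int n * t))"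
    and B: "T = (\<lambda>t. \<Sum>n\<in>B. d n * cis (of_int n * t))"
    using assms unfolding trig_poly_def by blast
  have "(\<lambda>t. S t * T t) = (\<lambda>t. \<Sum>m\<in>A. \<Sum>n\<in>B. (c m * d n) * cis (of_int (m + n) * t))"
  proof
    fix t
    have "cis (of_int (m + n) * t) = cis (of_int m * t) * cis (of_int n * t)" for m n
      by (simp add: cis_mult algebra_simps)
    then show "S t * T t = (\<Sum>m\<in>A. \<Sum>n\<in>B. (c m * d n) * cis (of_int (m + n) * t))"
      unfolding A B sum_product by (simp add: mult_ac)
  qed
  then show ?thesis by (simp only: trig_poly_sum trig_poly_monomial)
qed

text \<open>Links the polynomials of Stone-Weierstrass to exponentials. By Euler's formula a real
  linear functional of \<open>cis t\<close> involves only the frequencies 1 and -1; closure under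
  sums and products does the rest.\<close>

lemma trig_poly_real_polynomial_function:
  assumes "real_polynomial_function p"
  shows "trig_poly (\<lambda>t. of_real (p (cis t)))"
  using assms
proof (induction p rule: real_polynomial_function.induct)
  case (linear f)
  then interpret bounded_linear f .
  have "of_real (f (cis t)) =
      ((f 1 - \<i> * f \<i>) / 2) * cis (of_int 1 * t) + ((f 1 + \<i> * f \<i>) / 2) * cis (of_int (-1) * t)" for t
  proof -
    have "cis t = cos t *\<^sub>R 1 + sin t *\<^sub>R \<i>" by (simp add: complex_eq_iff)
    then have "f (cis t) = cos t * f 1 + sin t * f \<i>" by (metis add scaleR real_scaleR_def)
    then show ?thesis by (simp add: complex_eq_iff field_simps)
  qed
  then show ?case by (simp only: trig_poly_add trig_poly_monomial)
qed (auto intro: trig_poly_const trig_poly_add trig_poly_mult)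

lemma trig_poly_polynomial_function:
  assumes "polynomial_function p"
  shows "trig_poly (\<lambda>t. p (cis t))"
proof -
  have "trig_poly (\<lambda>t. of_real ((Re \<circ> p) (cis t)))" "trig_poly (\<lambda>t. of_real ((Im \<circ> p) (cis t)))"
    using assms bounded_linear_Re bounded_linear_Im
    by (auto simp only: polynomial_function_def intro!: trig_poly_real_polynomial_function)
  then have "trig_poly (\<lambda>t. of_real ((Re \<circ> p) (cis t)) + \<i> * of_real ((Im \<circ> p) (cis t)))"
    by (intro trig_poly_add trig_poly_mult trig_poly_const)
  moreover have "(\<lambda>t. of_real ((Re \<circ> p) (cis t)) + \<i> * of_real ((Im \<circ> p) (cis t))) = (\<lambda>t. p (cis t))"
    by (simp add: complex_eq_iff fun_eq_iff)
  ultimately show ?thesis by simp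
qed

lemma continuous_on_trig_poly: "trig_poly T \<Longrightarrow> continuous_on A T"
  unfolding trig_poly_def by (auto intro!: continuous_intros)

text \<open>Orthogonality reduces the pairing to a finite sum over the frequencies of
  \<open>T\<close>, and Cauchy-Schwarz separates the two factors. Bounding finite sums by
  \<open>Q\<close> avoids any infinite sum of coefficients.\<close>

lemma trig_poly_inner:
  assumes \<phi>: "integrable circle_measure \<phi>" and T: "trig_poly T"
    and Q: "\<And>A. finite A \<Longrightarrow> (\<Sum>n\<in>A. (norm (fourier_coeff \<phi> n))\<^sup>2) \<le> Q"
  shows "(norm (\<integral>t. \<phi> t * cnj (T t) \<partial>circle_measure))\<^sup>2 \<le>
    2*pi * Q * (\<integral>t. (norm (T t))\<^sup>2 \<partial>circle_measure)"
proof -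
  obtain A c where A: "finite A" and T: "T = (\<lambda>t. \<Sum>n\<in>A. c n * cis (of_int n * t))"
    using T unfolding trig_poly_def by blast
  have inner: "(\<integral>t. \<psi> t * cnj (T t) \<partial>circle_measure) = of_real (2*pi) * (\<Sum>n\<in>A. cnj (c n) * fourier_coeff \<psi> n)"
    if \<psi>: "integrable circle_measure \<psi>" for \<psi>
  proof -
    have "(\<integral>t. \<psi> t * cnj (T t) \<partial>circle_measure) =
        (\<integral>t. (\<Sum>n\<in>A. cnj (c n) * (\<psi> t * cis (- (of_int n * t)))) \<partial>circle_measure)"
      by (simp add: T sum_distrib_left mult_ac cis_cnj)
    also have "\<dots> = (\<Sum>n\<in>A. cnj (c n) * (\<integral>t. \<psi> t * cis (- (of_int n * t)) \<partial>circle_measure))"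
      using integrable_fourier_circle[OF \<psi>, of "- of_int _"]
      by (subst Bochner_Integration.integral_sum) auto
    also have "\<dots> = of_real (2*pi) * (\<Sum>n\<in>A. cnj (c n) * fourier_coeff \<psi> n)"
      unfolding integral_eq_fourier_coeff by (simp add: sum_distrib_left mult_ac)
    finally show ?thesis .
  qed
  have intT: "integrable circle_measure T"
    unfolding T by (intro Bochner_Integration.integrable_sum integrable_mult_right integrable_cis_circle)
  \<comment> \<open>The pairing formula applied to \<open>T\<close> itself is Parseval's identity
    for \<open>T\<close>.\<close>
  have "complex_of_real (\<integral>t. (norm (T t))\<^sup>2 \<partial>circle_measure) = (\<integral>t. T t * cnj (T t) \<partial>circle_measure)"
    by (simp only: integral_complex_of_real[symmetric] complex_norm_square)
  also have "\<dots> = of_real (2*pi) * (\<Sum>n\<in>A. cnj (c n) * fourier_coeff T n)"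
    by (rule inner[OF intT])
  also have "(\<Sum>n\<in>A. cnj (c n) * fourier_coeff T n) = (\<Sum>n\<in>A. cnj (c n) * c n)"
  proof (rule sum.cong[OF refl])
    fix n assume "n \<in> A"
    have "fourier_coeff T n = (\<Sum>m\<in>A. c m * (if m = n then 1 else 0))"
      unfolding T by (subst fourier_coeff_sum)
        (simp_all only: integrable_mult_right integrable_cis_circle fourier_coeff_mult_left fourier_coeff_cis)
    also have "\<dots> = (\<Sum>m\<in>A. if m = n then c m else 0)"
      by (intro sum.cong) auto
    also have "\<dots> = c n"
      using A \<open>n \<in> A\<close> by simp
    finally show "cnj (c n) * fourier_coeff T n = cnj (c n) * c n" by simp
  qed
  also have "of_real (2*pi) * (\<Sum>n\<in>A. cnj (c n) * c n) = complex_of_real (2*pi * (\<Sum>n\<in>A. (norm (c n))\<^sup>2))"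
    unfolding of_real_mult of_real_sum complex_norm_square by (simp add: mult.commute)
  finally have TT: "(\<integral>t. (norm (T t))\<^sup>2 \<partial>circle_measure) = 2*pi * (\<Sum>n\<in>A. (norm (c n))\<^sup>2)"
    by (simp only: of_real_eq_iff)
  have "norm (\<Sum>n\<in>A. cnj (c n) * fourier_coeff \<phi> n) \<le> (\<Sum>n\<in>A. norm (c n) * norm (fourier_coeff \<phi> n))"
    by (rule sum_norm_le) (simp add: norm_mult)
  then have "(norm (\<Sum>n\<in>A. cnj (c n) * fourier_coeff \<phi> n))\<^sup>2 \<le> (\<Sum>n\<in>A. norm (c n) * norm (fourier_coeff \<phi> n))\<^sup>2"
    by (intro power_mono) auto
  also have "\<dots> \<le> (\<Sum>n\<in>A. (norm (c n))\<^sup>2) * (\<Sum>n\<in>A. (norm (fourier_coeff \<phi> n))\<^sup>2)"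
    by (rule Cauchy_Schwarz_ineq_sum)
  also have "\<dots> \<le> (\<Sum>n\<in>A. (norm (c n))\<^sup>2) * Q"
    by (intro mult_left_mono Q A sum_nonneg) auto
  finally have "(2*pi)\<^sup>2 * (norm (\<Sum>n\<in>A. cnj (c n) * fourier_coeff \<phi> n))\<^sup>2 \<le>
      (2*pi)\<^sup>2 * ((\<Sum>n\<in>A. (norm (c n))\<^sup>2) * Q)"
    by (intro mult_left_mono) auto
  then show ?thesis
    unfolding inner[OF \<phi>] TT by (simp add: norm_mult power_mult_distrib power2_eq_square mult_ac)
qed

section \<open>Approximation by trigonometric polynomials and Parseval\<close>

lemma AE_circle_not_in_negligible:
  assumes "negligible N"
  shows "AE t in circle_measure. t \<notin> N"
proof -
  have "AE t in lebesgue. t \<notin> N"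
    using assms by (intro AE_not_in) (simp add: negligible_iff_null_sets)
  then show ?thesis
    unfolding circle_measure_def by (subst AE_restrict_space_iff) auto
qed

text \<open>The factor \<open>min 1 (r * norm (z - 1))\<close> removes the jump of \<open>Arg2pi\<close> at 1.\<close>

lemma continuous_on_sphere_Arg2pi:
  fixes g :: "real \<Rightarrow> complex"
  assumes g: "continuous_on UNIV g" and B: "\<And>t. norm (g t) \<le> B" and r: "0 \<le> r"
  shows "continuous_on (sphere 0 1) (\<lambda>z. of_real (min 1 (r * norm (z - 1))) * g (Arg2pi z))"
proof (rule continuous_at_imp_continuous_on, intro ballI)
  fix z :: complex assume z: "z \<in> sphere 0 1"
  show "isCont (\<lambda>z. of_real (min 1 (r * norm (z - 1))) * g (Arg2pi z)) z"
  proof (cases "z = 1")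
    case False
    have "z \<notin> \<real>\<^sub>\<ge>\<^sub>0"
    proof
      assume "z \<in> \<real>\<^sub>\<ge>\<^sub>0"
      then obtain x where "z = of_real x" "0 \<le> x" by (rule nonneg_Reals_cases)
      then show False using z False by simp
    qed
    then have "isCont Arg2pi z" by (rule continuous_at_Arg2pi)
    moreover have "isCont g (Arg2pi z)" using g by (simp add: continuous_on_eq_continuous_at)
    ultimately have "isCont (\<lambda>z. g (Arg2pi z)) z" by (rule isCont_o2)
    then show ?thesis by (intro continuous_intros)
  next
    case True
    have "((\<lambda>z. of_real (min 1 (r * norm (z - 1))) * g (Arg2pi z)) \<longlongrightarrow> 0) (at 1)"
    proof (rule Lim_null_comparison)
      show "\<forall>\<^sub>F z in at 1. norm (of_real (min 1 (r * norm (z - 1))) * g (Arg2pi z)) \<le> r * norm (z - 1) * B"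
      proof (rule always_eventually, rule allI)
        fix z :: complex
        have "norm (of_real (min 1 (r * norm (z - 1))) * g (Arg2pi z)) = min 1 (r * norm (z - 1)) * norm (g (Arg2pi z))"
          using r by (simp add: norm_mult)
        also have "\<dots> \<le> r * norm (z - 1) * B"
          using r B by (intro mult_mono) auto
        finally show "norm (of_real (min 1 (r * norm (z - 1))) * g (Arg2pi z)) \<le> r * norm (z - 1) * B" .
      qed
      have "((\<lambda>z::complex. r * norm (z - 1) * B) \<longlongrightarrow> r * norm (1 - 1 :: complex) * B) (at 1)"
        by (intro tendsto_intros)
      then show "((\<lambda>z::complex. r * norm (z - 1) * B) \<longlongrightarrow> 0) (at 1)" by simp
    qed
    then show ?thesis unfolding isCont_def True by simp
  qed
qed

text \<open>Continuous functions approximating \<open>\<beta>\<close> are truncated, carried to the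
  unit circle by \<open>Arg2pi\<close> with a cutoff at the seam, and approximated by
  Stone-Weierstrass. The extra 1 in the bound absorbs the last error.\<close>

lemma trig_poly_approx:
  assumes \<beta>: "\<beta> \<in> borel_measurable circle_measure"
    and B: "\<And>t. t \<in> {0..2*pi} \<Longrightarrow> norm (\<beta> t) \<le> B" "0 < B"
  obtains T where "\<And>j :: nat. trig_poly (T j)" "\<And>j t. norm (T j t) \<le> B + 1"
    "AE t in circle_measure. (\<lambda>j. T j t) \<longlonglongrightarrow> \<beta> t"
proof -
  have "\<beta> measurable_on {0..2*pi}"
    using \<beta> unfolding circle_measure_def by (subst measurable_on_iff_borel_measurable) auto
  then obtain N g where N: "negligible N" and g: "\<And>n. continuous_on UNIV (g n)"
    and lim: "\<And>t. t \<notin> N \<Longrightarrow> (\<lambda>n. g n t) \<longlonglongrightarrow> (if t \<in> {0..2*pi} then \<beta> t else 0)"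
    unfolding measurable_on_def by blast
  \<comment> \<open>Radial retraction onto the ball of radius \<open>B\<close>. It fixes the values
    of \<open>\<beta>\<close>, so the limit is unchanged.\<close>
  define G where "G n t = g n t /\<^sub>R max 1 (norm (g n t) / B)" for n t
  have contG: "continuous_on UNIV (G n)" for n
    unfolding G_def using B(2) by (intro continuous_intros g) (auto simp: max_def)
  have boundG: "norm (G n t) \<le> B" for n t
  proof -
    have "norm (g n t) \<le> max 1 (norm (g n t) / B) * B"
      using B(2) by (simp add: max_def field_simps)
    then show ?thesis unfolding G_def using B(2) by (simp add: field_simps abs_of_pos)
  qed
  have limG: "(\<lambda>n. G n t) \<longlonglongrightarrow> \<beta> t" if "t \<notin> N" "t \<in> {0..2*pi}" for t
  proof -
    have "(\<lambda>n. g n t) \<longlonglongrightarrow> \<beta> t" using lim[OF that(1)] that(2) by simp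
    then have "(\<lambda>n. G n t) \<longlonglongrightarrow> \<beta> t /\<^sub>R max 1 (norm (\<beta> t) / B)"
      unfolding G_def using B(2) by (intro tendsto_intros) (auto simp: max_def)
    then show ?thesis using B(1)[OF that(2)] B(2) by (simp add: max_def field_simps split: if_splits)
  qed
  define \<Psi> where "\<Psi> n z = of_real (min 1 (real n * norm (z - 1))) * G n (Arg2pi z)" for n z
  have "\<exists>p. polynomial_function p \<and> (\<forall>z \<in> sphere 0 1. norm (\<Psi> n z - p z) < 1 / (real n + 1))" for n
    unfolding \<Psi>_def
    by (intro Stone_Weierstrass_polynomial_function compact_sphere continuous_on_sphere_Arg2pi[where B = B] contG boundG) auto
  then obtain p where p: "\<And>n. polynomial_function (p n)"
    and close: "\<And>n z. z \<in> sphere 0 1 \<Longrightarrow> norm (\<Psi> n z - p n z) < 1 / (real n + 1)"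
    by metis
  show thesis
  proof
    show "trig_poly (\<lambda>t. p j (cis t))" for j
      by (rule trig_poly_polynomial_function[OF p])
    show "norm (p j (cis t)) \<le> B + 1" for j t
    proof -
      have "norm (\<Psi> j (cis t)) \<le> 1 * B"
        unfolding \<Psi>_def norm_mult using boundG[of j] by (intro mult_mono) auto
      moreover have "norm (\<Psi> j (cis t) - p j (cis t)) \<le> 1"
        using close[of "cis t" j] by (rule order_trans[OF less_imp_le]) auto
      ultimately show ?thesis
        using norm_triangle_sub[of "p j (cis t)" "\<Psi> j (cis t)"] by (simp add: norm_minus_commute)
    qed
    \<comment> \<open>The endpoints are discarded because both map to the seam 1, where the cutoff
      vanishes. At any other fixed point the cutoff is eventually 1.\<close>
    have "negligible (N \<union> {0, 2*pi})" using N by simp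
    from AE_circle_not_in_negligible[OF this]
    show "AE t in circle_measure. (\<lambda>j. p j (cis t)) \<longlonglongrightarrow> \<beta> t"
    proof (rule AE_mp, intro AE_I2 impI)
      fix t assume "t \<in> space circle_measure" "t \<notin> N \<union> {0, 2*pi}"
      then have t: "0 < t" "t < 2*pi" "t \<notin> N" "t \<in> {0..2*pi}" by auto
      have Arg: "Arg2pi (cis t) = t"
        using Arg2pi_exp[of "\<i> * of_real t"] t by (simp add: cis_conv_exp)
      then have "cis t \<noteq> 1" using t Arg2pi_of_real[of 1] by auto
      then have pos: "0 < norm (cis t - 1)" by simp
      have "\<forall>\<^sub>F n in sequentially. \<Psi> n (cis t) = G n t"
      proof -
        have "\<forall>\<^sub>F n in sequentially. 1 / norm (cis t - 1) \<le> real n"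
          by (rule eventually_sequentiallyI[of "nat \<lceil>1 / norm (cis t - 1)\<rceil>"]) linarith
        then show ?thesis
        proof eventually_elim
          case (elim n)
          then have "1 \<le> real n * norm (cis t - 1)" using pos by (simp add: field_simps)
          then show ?case by (simp add: \<Psi>_def Arg min_def)
        qed
      qed
      then have "(\<lambda>n. \<Psi> n (cis t)) \<longlonglongrightarrow> \<beta> t"
        using limG[OF t(3,4)] by (simp add: tendsto_cong)
      moreover have "(\<lambda>n. \<Psi> n (cis t) - p n (cis t)) \<longlonglongrightarrow> 0"
      proof (rule Lim_null_comparison)
        show "\<forall>\<^sub>F n in sequentially. norm (\<Psi> n (cis t) - p n (cis t)) \<le> 1 / (real n + 1)"
          using close[of "cis t"] by (intro always_eventually allI less_imp_le) simp
        show "(\<lambda>n. 1 / (real n + 1)) \<longlonglongrightarrow> 0"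
          using LIMSEQ_inverse_real_of_nat by (simp add: inverse_eq_divide add.commute)
      qed
      ultimately have "(\<lambda>n. \<Psi> n (cis t) - (\<Psi> n (cis t) - p n (cis t))) \<longlonglongrightarrow> \<beta> t - 0"
        by (intro tendsto_diff)
      then show "(\<lambda>j. p j (cis t)) \<longlonglongrightarrow> \<beta> t" by simp
    qed
  qed
qed

text \<open>Extends the inequality for trigonometric polynomials by dominated convergence. Since
  \<open>\<phi>\<close> is only integrable here, the uniform bound on the approximants supplies the
  dominating function.\<close>

lemma bounded_inner_le:
  assumes \<phi>: "integrable circle_measure \<phi>"
    and Q: "\<And>A. finite A \<Longrightarrow> (\<Sum>n\<in>A. (norm (fourier_coeff \<phi> n))\<^sup>2) \<le> Q"
    and \<beta>: "\<beta> \<in> borel_measurable circle_measure"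
    and B: "\<And>t. t \<in> {0..2*pi} \<Longrightarrow> norm (\<beta> t) \<le> B"
  shows "(norm (\<integral>t. \<phi> t * cnj (\<beta> t) \<partial>circle_measure))\<^sup>2 \<le>
    2*pi * Q * (\<integral>t. (norm (\<beta> t))\<^sup>2 \<partial>circle_measure)"
proof -
  \<comment> \<open>\<open>max B 1\<close> provides the positive bound that the approximation lemma
    asks for.\<close>
  have B': "norm (\<beta> t) \<le> max B 1" if "t \<in> {0..2*pi}" for t using B[OF that] by simp
  obtain T where T: "\<And>j :: nat. trig_poly (T j)" "\<And>j t. norm (T j t) \<le> max B 1 + 1"
    and lim: "AE t in circle_measure. (\<lambda>j. T j t) \<longlonglongrightarrow> \<beta> t"
    using trig_poly_approx[OF \<beta> B'] zero_less_one max.strict_coboundedI2 by blast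
  have Tm [measurable]: "T j \<in> borel_measurable circle_measure" for j
    by (intro borel_measurable_circle_continuous continuous_on_trig_poly T)
  have [measurable]: "cnj \<in> borel_measurable borel"
    by (intro borel_measurable_continuous_onI continuous_intros)
  note \<beta> [measurable] and \<phi>m [measurable] = borel_measurable_integrable[OF \<phi>]
  have "(\<lambda>j. \<integral>t. \<phi> t * cnj (T j t) \<partial>circle_measure) \<longlonglongrightarrow> (\<integral>t. \<phi> t * cnj (\<beta> t) \<partial>circle_measure)"
  proof (rule integral_dominated_convergence)
    show "integrable circle_measure (\<lambda>t. norm (\<phi> t) * (max B 1 + 1))"
      using \<phi> by simp
    show "AE t in circle_measure. (\<lambda>j. \<phi> t * cnj (T j t)) \<longlonglongrightarrow> \<phi> t * cnj (\<beta> t)"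
      using lim by eventually_elim (intro tendsto_intros)
    show "AE t in circle_measure. norm (\<phi> t * cnj (T j t)) \<le> norm (\<phi> t) * (max B 1 + 1)" for j
      using T(2)[of j] by (intro AE_I2) (simp add: norm_mult mult_left_mono)
  qed measurable
  moreover have "(\<lambda>j. \<integral>t. (norm (T j t))\<^sup>2 \<partial>circle_measure) \<longlonglongrightarrow> (\<integral>t. (norm (\<beta> t))\<^sup>2 \<partial>circle_measure)"
  proof (rule integral_dominated_convergence)
    show "integrable circle_measure (\<lambda>t. (max B 1 + 1)\<^sup>2)"
      by simp
    show "AE t in circle_measure. (\<lambda>j. (norm (T j t))\<^sup>2) \<longlonglongrightarrow> (norm (\<beta> t))\<^sup>2"
      using lim by eventually_elim (intro tendsto_intros)
    show "AE t in circle_measure. norm ((norm (T j t))\<^sup>2) \<le> (max B 1 + 1)\<^sup>2" for j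
      using T(2)[of j] by (intro AE_I2) (simp add: power_mono)
  qed measurable
  ultimately show ?thesis
    by (intro LIMSEQ_le[OF tendsto_power[OF tendsto_norm] tendsto_mult_left])
      (use trig_poly_inner[OF \<phi> T(1) Q] in auto)
qed

text \<open>The completeness half of Parseval. Testing \<open>\<phi>\<close> against its own
  truncation \<open>\<beta> k\<close> gives \<open>X k * X k \<le> 2*pi * Q * X k\<close>; after
  cancelling, \<open>k\<close> tends to infinity.\<close>

lemma integral_norm_square_le_fourier:
  assumes \<phi>m: "\<phi> \<in> borel_measurable circle_measure"
    and \<phi>2: "integrable circle_measure (\<lambda>t. (norm (\<phi> t))\<^sup>2)"
    and Q: "\<And>A. finite A \<Longrightarrow> (\<Sum>n\<in>A. (norm (fourier_coeff \<phi> n))\<^sup>2) \<le> Q"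
  shows "(\<integral>t. (norm (\<phi> t))\<^sup>2 \<partial>circle_measure) \<le> 2*pi * Q"
proof -
  note \<phi>m [measurable]
  have \<phi>: "integrable circle_measure \<phi>"
    by (rule integrable_circle_of_square_integrable[OF \<phi>m \<phi>2])
  have Q0: "0 \<le> Q" using Q[of "{}"] by simp
  define \<beta> where "\<beta> k t = (if norm (\<phi> t) \<le> real k then \<phi> t else 0)" for k t
  have \<beta>m [measurable]: "\<beta> k \<in> borel_measurable circle_measure" for k
    unfolding \<beta>_def by measurable
  define X where "X k = (\<integral>t. (norm (\<beta> k t))\<^sup>2 \<partial>circle_measure)" for k
  have X0: "0 \<le> X k" for k unfolding X_def by (intro integral_nonneg_AE) simp
  have "X k \<le> 2*pi * Q" for k
  proof -
    have "\<phi> t * cnj (\<beta> k t) = of_real ((norm (\<beta> k t))\<^sup>2)" for t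
      unfolding complex_norm_square by (simp add: \<beta>_def)
    then have "(\<integral>t. \<phi> t * cnj (\<beta> k t) \<partial>circle_measure) = of_real (X k)"
      unfolding X_def by (simp only: integral_complex_of_real)
    moreover have "(norm (\<integral>t. \<phi> t * cnj (\<beta> k t) \<partial>circle_measure))\<^sup>2 \<le> 2*pi * Q * X k"
      unfolding X_def by (rule bounded_inner_le[OF \<phi> Q \<beta>m, of _ "real k"]) (auto simp: \<beta>_def)
    ultimately have "X k * X k \<le> 2*pi * Q * X k" by (simp add: power2_eq_square)
    then show ?thesis using X0[of k] Q0
      by (cases "X k = 0") (auto simp: mult_le_cancel_right)
  qed
  moreover have "X \<longlonglongrightarrow> (\<integral>t. (norm (\<phi> t))\<^sup>2 \<partial>circle_measure)"
    unfolding X_def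
  proof (rule integral_dominated_convergence[OF _ _ \<phi>2])
    show "AE t in circle_measure. (\<lambda>k. (norm (\<beta> k t))\<^sup>2) \<longlonglongrightarrow> (norm (\<phi> t))\<^sup>2"
    proof (rule AE_I2)
      fix t
      have "\<forall>\<^sub>F k in sequentially. (norm (\<beta> k t))\<^sup>2 = (norm (\<phi> t))\<^sup>2"
        by (rule eventually_sequentiallyI[of "nat \<lceil>norm (\<phi> t)\<rceil>"]) (simp add: \<beta>_def nat_ceiling_le_eq)
      then show "(\<lambda>k. (norm (\<beta> k t))\<^sup>2) \<longlonglongrightarrow> (norm (\<phi> t))\<^sup>2"
        by (rule tendsto_eventually)
    qed
    show "AE t in circle_measure. norm ((norm (\<beta> k t))\<^sup>2) \<le> (norm (\<phi> t))\<^sup>2" for k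
      by (intro AE_I2) (simp add: \<beta>_def)
  qed measurable
  ultimately show ?thesis
    by (intro LIMSEQ_le_const2[of X]) auto
qed

subsection \<open>Shifted partial sums\<close>

text \<open>Continuity from above of a finite measure. It plays the role of Egorov's theorem:
  pointwise boundedness or smallness becomes uniform off a set of small measure.\<close>

lemma small_measure_of_AE_decreasing:
  fixes A :: "nat \<Rightarrow> real set"
  assumes A: "\<And>n. A n \<in> sets circle_measure" and dec: "decseq A"
    and AE: "AE t in circle_measure. \<exists>n. t \<notin> A n" and e: "0 < e"
  obtains n where "n0 \<le> n" "measure circle_measure (A n) < e"
proof -
  have sets: "(\<Inter>n. A n) \<in> sets circle_measure" using A by auto
  have "AE t in circle_measure. t \<notin> (\<Inter>n. A n)"
    using AE by eventually_elim auto
  then have "(\<Inter>n. A n) \<in> null_sets circle_measure"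
    using AE_iff_null_sets[OF sets] by simp
  then have "measure circle_measure (\<Inter>n. A n) = 0"
    by (rule measure_eq_0_null_sets)
  then have "(\<lambda>n. measure circle_measure (A n)) \<longlonglongrightarrow> 0"
    using circle.finite_Lim_measure_decseq[of A] A dec by auto
  then have "\<forall>\<^sub>F n in sequentially. measure circle_measure (A n) < e"
    using e by (rule order_tendstoD)
  moreover have "\<forall>\<^sub>F n in sequentially. n0 \<le> n" by (rule eventually_ge_at_top)
  ultimately have "\<forall>\<^sub>F n in sequentially. n0 \<le> n \<and> measure circle_measure (A n) < e"
    by eventually_elim simp
  then show thesis using that by (auto dest!: eventually_happens'[OF sequentially_bot])
qed

lemma sets_circle_measure_iff: "A \<in> sets circle_measure \<longleftrightarrow> A \<in> sets lebesgue \<and> A \<subseteq> {0..2*pi}"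
  unfolding circle_measure_def by (subst sets_restrict_space_iff) auto

lemma bounded_lmeasurable_circle: "\<lbrakk>A \<in> sets lebesgue; A \<subseteq> {0..2*pi}\<rbrakk> \<Longrightarrow> A \<in> lmeasurable"
  by (rule bounded_set_imp_lmeasurable[OF bounded_subset[OF bounded_closed_interval]])

text \<open>Multiplying the difference \<open>S N (t + s) - S N t\<close> by \<open>cis (m t)\<close> and adding \<open>2 a\<close> gives an
  analytic polynomial with constant coefficient \<open>2 a\<close> which is small on most of the circle.\<close>

lemma amplitude_bound:
  fixes c :: "nat \<Rightarrow> complex" and g :: "real \<Rightarrow> complex"
  assumes S: "\<And>N t. S N t = (\<Sum>n<N. c n * cis (real n * t))"
    and X: "X \<in> sets lebesgue" "X \<subseteq> {0..2*pi}" "measure lebesgue X \<le> 1/50"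
    and bounded: "\<And>N t. t \<in> {0..2*pi} - X \<Longrightarrow> norm (S N t) \<le> M"
    and lim: "\<And>t. t \<in> {0..2*pi} - X \<Longrightarrow> (\<lambda>N. S N t) \<longlonglongrightarrow> g t"
    and s: "0 \<le> s" "s \<le> 1/50"
    and close: "\<And>t. \<lbrakk>t \<in> {0..2*pi} - X; t + s \<in> {0..2*pi} - X\<rbrakk> \<Longrightarrow>
      norm (g (t + s) - g t + of_real (2 * a) * cis (- (real m * t))) \<le> \<eta> / 2"
    and m: "0 < m" and a: "0 \<le> a" "a \<le> 1" and M: "1 \<le> M" and \<eta>: "0 < \<eta>" "\<eta> \<le> 1"
  shows "2 * a \<le> 3 * (2 + 2 * M) * sqrt \<eta>"
proof -
  \<comment> \<open>Multiplication by \<open>cis (m t)\<close> raises frequencies by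
    \<open>m\<close>, so partial sum \<open>p\<close> of the new series uses partial sum
    \<open>p - m\<close> of the old one; truncated subtraction makes that empty for
    \<open>p \<le> m\<close>. The case \<open>p = 0\<close> precedes the constant term. Since
    \<open>0 < m\<close>, no shifted frequency meets 0.\<close>
  define V where "V p t = (if p = 0 then 0 else of_real (2 * a)) + cis (real m * t) * (S (p - m) (t + s) - S (p - m) t)" for p t
  define C where "C j = (if j = 0 then of_real (2 * a) else if m \<le> j then c (j - m) * (cis (real (j - m) * s) - 1) else 0)" for j
  have V_eq: "(\<Sum>j<p. C j * cis (real j * t)) = V p t" for p t
  proof (induction p)
    case 0
    then show ?case by (simp add: V_def S)
  next
    case (Suc p)
    consider "p = 0" | "p \<noteq> 0" "p < m" | "m \<le> p" by linarith
    then have "C p * cis (real p * t) = V (Suc p) t - V p t"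
    proof cases
      case 1
      then show ?thesis using m by (simp add: V_def C_def S)
    next
      case 2
      then show ?thesis by (simp add: V_def C_def S)
    next
      case 3
      define q where "q = p - m"
      have p: "p = q + m" using 3 by (simp add: q_def)
      have e1: "cis (real q * (t + s)) = cis (real q * s) * cis (real q * t)"
        and e2: "cis (real p * t) = cis (real m * t) * cis (real q * t)"
        unfolding p by (simp_all add: cis_mult algebra_simps)
      have Vd: "V (Suc p) t - V p t = cis (real m * t) * (c q * cis (real q * (t + s)) - c q * cis (real q * t))"
        using m unfolding p by (simp add: V_def S Suc_diff_le algebra_simps)
      have Cp: "C p = c q * (cis (real q * s) - 1)"
        using m unfolding p by (simp add: C_def)
      show ?thesis unfolding Cp Vd e2 e1
        by (simp only: left_diff_distrib right_diff_distrib mult_1_left mult_ac)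
    qed
    then show ?case using Suc by simp
  qed
  define X' where "X' = (+) (- s) ` X"
  have Xm: "X \<in> lmeasurable" using X bounded_lmeasurable_circle by blast
  have X': "X' \<in> lmeasurable" "measure lebesgue X' = measure lebesgue X"
    unfolding X'_def using measurable_translation[OF Xm, of "- s"] measure_translation[of "- s" X] by blast+
  \<comment> \<open>The translate handles \<open>t + s\<close> in \<open>X\<close>, and the last
    interval handles \<open>t + s\<close> leaving the circle's parameter range. Each piece has
    measure at most 1/50; with another 1/50 for \<open>A N\<close> the total 4/50 is below
    1/12.\<close>
  define Y where "Y = X \<union> X' \<union> {2*pi - s..2*pi}"
  have Ym: "Y \<in> lmeasurable"
    unfolding Y_def using Xm X' by (intro fmeasurable.Un) auto
  have Yle: "measure lebesgue Y \<le> 3/50"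
  proof -
    have "measure lebesgue Y \<le> measure lebesgue X + measure lebesgue X' + measure lebesgue {2*pi - s..2*pi}"
      unfolding Y_def using Xm X'
      by (intro order_trans[OF measure_Un_le] add_mono) (auto intro: fmeasurableD)
    then show ?thesis using X' X(3) s by simp
  qed
  define H where "H = {0..2*pi} - Y"
  have H_sets: "H \<in> sets circle_measure"
    unfolding H_def sets_circle_measure_iff using Ym by (auto intro: fmeasurableD)
  have H: "t \<in> {0..2*pi} - X" "t + s \<in> {0..2*pi} - X" if "t \<in> H" for t
  proof -
    have "t \<notin> X'" using that by (simp add: H_def Y_def)
    then have "t + s \<notin> X" unfolding X'_def by (metis add.commute add_minus_cancel image_eqI)
    then show "t \<in> {0..2*pi} - X" "t + s \<in> {0..2*pi} - X"
      using that s by (auto simp: H_def Y_def)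
  qed
  have V_cont: "V p \<in> borel_measurable circle_measure" for p
    unfolding V_def S by (intro borel_measurable_circle_continuous continuous_intros)
  \<comment> \<open>These sets decrease to the empty set because \<open>V p t\<close> converges on
    \<open>H\<close> to a limit of norm at most \<open>\<eta> / 2\<close>. Hence one
    \<open>N\<close> works off a small set.\<close>
  define A where "A n = {t \<in> space circle_measure. t \<in> H \<and> (\<exists>p\<ge>n. \<eta> < norm (V p t))}" for n
  have A_sets: "A n \<in> sets circle_measure" for n
    unfolding A_def using V_cont H_sets by measurable
  have A_dec: "decseq A"
    unfolding A_def decseq_def by (auto intro: order_trans)
  have "\<exists>n. t \<notin> A n" for t
  proof (cases "t \<in> H")
    case True
    let ?W = "of_real (2 * a) + cis (real m * t) * (g (t + s) - g t)"
    have "(\<lambda>p. S (p - m) (t + s)) \<longlonglongrightarrow> g (t + s)" "(\<lambda>p. S (p - m) t) \<longlonglongrightarrow> g t"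
      using lim[OF H(1)[OF True]] lim[OF H(2)[OF True]] LIMSEQ_offset[of "\<lambda>p. S (p - m) _" m] by auto
    then have "(\<lambda>p. of_real (2 * a) + cis (real m * t) * (S (p - m) (t + s) - S (p - m) t)) \<longlonglongrightarrow> ?W"
      by (intro tendsto_intros)
    moreover have "\<forall>\<^sub>F p in sequentially. of_real (2 * a) + cis (real m * t) * (S (p - m) (t + s) - S (p - m) t) = V p t"
      using eventually_gt_at_top[of 0] by eventually_elim (simp add: V_def)
    ultimately have "(\<lambda>p. V p t) \<longlonglongrightarrow> ?W"
      by (rule Lim_transform_eventually)
    then have "(\<lambda>p. norm (V p t)) \<longlonglongrightarrow> norm ?W" by (rule tendsto_norm)
    moreover have "norm ?W < \<eta>"
    proof -
      have "norm ?W = norm (cis (- (real m * t)) * ?W)" by (simp add: norm_mult)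
      also have "cis (- (real m * t)) * ?W = g (t + s) - g t + of_real (2 * a) * cis (- (real m * t))"
        by (simp add: distrib_left mult.assoc[symmetric] cis_mult)
      finally show ?thesis using close[OF H(1)[OF True] H(2)[OF True]] \<eta> by simp
    qed
    ultimately have "\<forall>\<^sub>F p in sequentially. norm (V p t) < \<eta>" by (rule order_tendstoD)
    then show ?thesis unfolding eventually_sequentially A_def by force
  qed (simp add: A_def)
  then obtain N where N: "1 \<le> N" "measure circle_measure (A N) < 1/50"
    using small_measure_of_AE_decreasing[OF A_sets A_dec, of "1/50" 1] by auto
  define G where "G = H - A N"
  have Gs: "G \<in> sets circle_measure" unfolding G_def using H_sets A_sets by blast
  have "norm (C 0) \<le> 3 * (2 + 2 * M) * sqrt \<eta>"
  proof (rule norm_constant_coeff_le[of G N C])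
    show "G \<in> sets lebesgue" "G \<subseteq> {0..2*pi}"
      using Gs by (auto simp: sets_circle_measure_iff)
    have AN: "A N \<in> sets lebesgue" "A N \<subseteq> {0..2*pi}"
      using A_sets[of N] by (auto simp: sets_circle_measure_iff)
    have "{0..2*pi} - G \<subseteq> Y \<union> A N" by (auto simp: G_def H_def)
    then have "measure lebesgue ({0..2*pi} - G) \<le> measure lebesgue (Y \<union> A N)"
      using Gs by (intro measure_mono_fmeasurable fmeasurable.Un[OF Ym bounded_lmeasurable_circle[OF AN]])
        (auto simp: sets_circle_measure_iff)
    also have "\<dots> \<le> measure lebesgue Y + measure lebesgue (A N)"
      using Ym AN by (intro measure_Un_le) (auto intro: fmeasurableD)
    also have "\<dots> \<le> 1/12"
      using Yle N(2) AN(2) by (simp add: measure_circle_measure)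
    finally show "measure lebesgue ({0..2*pi} - G) \<le> 1/12" .
    show "norm (\<Sum>n<p. C n * cis (real n * t)) \<le> 2 + 2 * M" if "t \<in> G" "p \<le> N" for t p
    proof -
      have "norm (V p t) \<le> 2 * a + 1 * (norm (S (p - m) (t + s)) + norm (S (p - m) t))"
        unfolding V_def using a
        by (intro order_trans[OF norm_triangle_ineq] add_mono)
          (auto simp: norm_mult norm_triangle_ineq4)
      also have "\<dots> \<le> 2 * 1 + 1 * (M + M)"
        using that H[of t] a by (intro add_mono mult_left_mono bounded) (auto simp: G_def)
      finally show ?thesis by (simp add: V_eq)
    qed
    show "norm (\<Sum>n<N. C n * cis (real n * t)) \<le> \<eta>" if "t \<in> G" for t
      using that H_sets by (force simp: V_eq G_def A_def sets_circle_measure_iff)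
  qed (use \<eta> M N in auto)
  then show ?thesis using a by (simp add: C_def)
qed

section \<open>Fourier partial sums and remainders\<close>

definition fourier_partial :: "(real \<Rightarrow> complex) \<Rightarrow> nat \<Rightarrow> real \<Rightarrow> complex" where
  "fourier_partial h K t = (\<Sum>n\<in>{- int K..int K}. fourier_coeff h n * cis (of_int n * t))"

lemma continuous_on_fourier_partial [continuous_intros]: "continuous_on A (fourier_partial h K)"
  unfolding fourier_partial_def by (intro continuous_intros)

lemma fourier_coeff_partial:
  "fourier_coeff (fourier_partial h K) n = (if \<bar>n\<bar> \<le> int K then fourier_coeff h n else 0)"
proof -
  have "fourier_coeff (fourier_partial h K) n =
      (\<Sum>m\<in>{- int K..int K}. fourier_coeff h m * (if m = n then 1 else 0))"
    unfolding fourier_partial_def by (subst fourier_coeff_sum)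
      (simp_all only: integrable_mult_right integrable_cis_circle fourier_coeff_mult_left fourier_coeff_cis)
  also have "\<dots> = (\<Sum>m\<in>{- int K..int K}. if m = n then fourier_coeff h m else 0)"
    by (intro sum.cong) auto
  finally show ?thesis by auto
qed

text \<open>Each of the \<open>2 * K + 1\<close> terms is Lipschitz with constant at most
  \<open>C * K\<close>. This crude bound is enough because the shift is chosen after
  \<open>K\<close>.\<close>

lemma fourier_partial_shift:
  assumes C: "\<And>n. norm (fourier_coeff h n) \<le> C" and s: "0 \<le> s"
  shows "norm (fourier_partial h K (t + s) - fourier_partial h K t) \<le> real (2 * K + 1) * (C * (real K * s))"
proof -
  have C0: "0 \<le> C" using C[of 0] norm_ge_zero order_trans by blast
  have "fourier_partial h K (t + s) - fourier_partial h K t =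
      (\<Sum>n\<in>{- int K..int K}. fourier_coeff h n * (cis (of_int n * (t + s)) - cis (of_int n * t)))"
    by (simp add: fourier_partial_def sum_subtractf right_diff_distrib)
  also have "norm \<dots> \<le> (\<Sum>n\<in>{- int K..int K}. C * (real K * s))"
  proof (rule sum_norm_le)
    fix n assume n: "n \<in> {- int K..int K}"
    have "norm (cis (of_int n * (t + s)) - cis (of_int n * t)) \<le> \<bar>of_int n * (t + s) - of_int n * t\<bar>"
      by (rule norm_cis_diff_le)
    also have "\<dots> = \<bar>of_int n\<bar> * s" using s by (simp add: right_diff_distrib[symmetric] abs_mult)
    also have "\<dots> \<le> real K * s" using n s by (intro mult_right_mono) auto
    finally show "norm (fourier_coeff h n * (cis (of_int n * (t + s)) - cis (of_int n * t))) \<le> C * (real K * s)"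
      unfolding norm_mult using C C0 by (intro mult_mono) auto
  qed
  also have "\<dots> = real (2 * K + 1) * (C * (real K * s))" by (simp add: nat_add_distrib nat_mult_distrib)
  finally show ?thesis .
qed

text \<open>The remainder has no frequencies up to \<open>K\<close>, and beyond \<open>K\<close> the
  weight is at least \<open>\<omega> K\<close>, so its squared coefficients sum to at most
  \<open>W / (\<omega> K)\<^sup>2\<close>. Parseval and Markov's inequality finish.\<close>

lemma fourier_remainder_measure:
  assumes h: "h \<in> borel_measurable circle_measure" "integrable circle_measure (\<lambda>t. (norm (h t))\<^sup>2)"
    and W: "\<And>A. finite A \<Longrightarrow> (\<Sum>n\<in>A. (norm (fourier_coeff h n))\<^sup>2 * (\<omega> (nat \<bar>n\<bar>))\<^sup>2) \<le> W"
    and \<omega>: "\<And>n. 0 < \<omega> n" "mono \<omega>" and e: "0 < e"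
  shows "measure circle_measure {t \<in> space circle_measure. e \<le> norm (h t - fourier_partial h K t)}
    \<le> 2*pi * W / ((\<omega> K)\<^sup>2 * e\<^sup>2)"
proof -
  define r where "r t = h t - fourier_partial h K t" for t
  note h(1) [measurable]
  have Pm [measurable]: "fourier_partial h K \<in> borel_measurable circle_measure"
    by (intro borel_measurable_circle_continuous continuous_intros)
  have rm [measurable]: "r \<in> borel_measurable circle_measure" unfolding r_def by measurable
  have hi: "integrable circle_measure h" by (rule integrable_circle_of_square_integrable[OF h])
  have Pi: "integrable circle_measure (fourier_partial h K)"
    unfolding fourier_partial_def
    by (intro Bochner_Integration.integrable_sum integrable_mult_right integrable_cis_circle)
  have r2: "integrable circle_measure (\<lambda>t. (norm (r t))\<^sup>2)"
  proof (rule Bochner_Integration.integrable_bound)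
    have "integrable circle_measure (\<lambda>t. (norm (fourier_partial h K t))\<^sup>2)"
    proof (rule circle.integrable_const_bound)
      show "AE t in circle_measure. norm ((norm (fourier_partial h K t))\<^sup>2) \<le>
          (\<Sum>n\<in>{- int K..int K}. norm (fourier_coeff h n))\<^sup>2"
        by (intro AE_I2) (auto simp: fourier_partial_def norm_mult intro!: power_mono sum_norm_le)
    qed measurable
    then show "integrable circle_measure (\<lambda>t. 2 * (norm (h t))\<^sup>2 + 2 * (norm (fourier_partial h K t))\<^sup>2)"
      using h(2) by simp
    have "(norm (x - y))\<^sup>2 \<le> 2 * (norm x)\<^sup>2 + 2 * (norm y)\<^sup>2" for x y :: complex
    proof -
      have "(norm (x - y))\<^sup>2 \<le> (norm x + norm y)\<^sup>2"
        by (intro power_mono norm_triangle_ineq4) simp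
      also have "\<dots> \<le> 2 * (norm x)\<^sup>2 + 2 * (norm y)\<^sup>2"
        using sum_squares_ge_zero[of "norm x - norm y" 0] by (simp add: power2_eq_square algebra_simps)
      finally show ?thesis .
    qed
    then show "AE t in circle_measure. norm ((norm (r t))\<^sup>2) \<le>
        norm (2 * (norm (h t))\<^sup>2 + 2 * (norm (fourier_partial h K t))\<^sup>2)"
      unfolding r_def by (intro AE_I2) simp
  qed measurable
  have \<omega>0: "0 < \<omega> K" by (rule \<omega>)
  have "(\<Sum>n\<in>A. (norm (fourier_coeff r n))\<^sup>2) \<le> W / (\<omega> K)\<^sup>2" if A: "finite A" for A
  proof -
    have "(\<omega> K)\<^sup>2 * (norm (fourier_coeff r n))\<^sup>2 \<le> (norm (fourier_coeff h n))\<^sup>2 * (\<omega> (nat \<bar>n\<bar>))\<^sup>2" for n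
    proof (cases "\<bar>n\<bar> \<le> int K")
      case True
      then show ?thesis
        unfolding r_def by (subst fourier_coeff_diff[OF hi Pi]) (simp add: fourier_coeff_partial)
    next
      case False
      then have "\<omega> K \<le> \<omega> (nat \<bar>n\<bar>)" by (intro monoD[OF \<omega>(2)]) simp
      then have "(\<omega> K)\<^sup>2 \<le> (\<omega> (nat \<bar>n\<bar>))\<^sup>2" using \<omega>0 by (intro power_mono) auto
      then have "(norm (fourier_coeff h n))\<^sup>2 * (\<omega> K)\<^sup>2 \<le> (norm (fourier_coeff h n))\<^sup>2 * (\<omega> (nat \<bar>n\<bar>))\<^sup>2"
        by (intro mult_left_mono) auto
      then show ?thesis using False
        unfolding r_def by (subst fourier_coeff_diff[OF hi Pi]) (simp add: fourier_coeff_partial mult.commute)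
    qed
    then have "(\<Sum>n\<in>A. (\<omega> K)\<^sup>2 * (norm (fourier_coeff r n))\<^sup>2) \<le> W"
      by (intro order_trans[OF sum_mono W[OF A]])
    then show ?thesis using \<omega>0 by (simp add: sum_distrib_left[symmetric] field_simps)
  qed
  then have "(\<integral>t. (norm (r t))\<^sup>2 \<partial>circle_measure) \<le> 2*pi * (W / (\<omega> K)\<^sup>2)"
    by (rule integral_norm_square_le_fourier[OF rm r2])
  then have "(\<integral>t. (norm (r t))\<^sup>2 \<partial>circle_measure) / e\<^sup>2 \<le> 2*pi * (W / (\<omega> K)\<^sup>2) / e\<^sup>2"
    by (rule divide_right_mono) simp
  moreover have "measure circle_measure {t \<in> space circle_measure. e\<^sup>2 \<le> (norm (r t))\<^sup>2} \<le>
      (\<integral>t. (norm (r t))\<^sup>2 \<partial>circle_measure) / e\<^sup>2"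
    using e by (intro integral_Markov_inequality_measure[OF r2, of "{}"]) auto
  moreover have "(e\<^sup>2 \<le> (norm (r t))\<^sup>2) = (e \<le> norm (r t))" for t
    using e by (simp add: power2_le_iff_abs_le abs_le_square_iff[symmetric])
  ultimately show ?thesis unfolding r_def by simp
qed

subsection \<open>Lacunary series\<close>

definition lacunary :: "(nat \<Rightarrow> real) \<Rightarrow> (nat \<Rightarrow> nat) \<Rightarrow> real \<Rightarrow> complex" where
  "lacunary a n t = (\<Sum>k. of_real (a k) * cis (- (real (n k) * t)))"

lemma summable_lacunary:
  assumes "summable a" "\<And>k. 0 \<le> a k"
  shows "summable (\<lambda>k. of_real (a k) * cis (- (real (n k) * t)))"
  by (rule summable_norm_cancel) (use assms in \<open>simp add: norm_mult\<close>)

text \<open>Absolute convergence permits termwise integration. As the frequencies are distinct, the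
  nonzero Fourier coefficients are among the \<open>a k\<close>, each occurring at its own
  frequency.\<close>

lemma lacunary_in_wiener_algebra:
  assumes a: "summable a" "\<And>k. 0 \<le> a k" and n: "inj n"
  shows "lacunary a n \<in> wiener_algebra"
proof -
  have int: "integrable circle_measure (\<lambda>t. of_real (a k) * cis (b * t))" for k b
    by (intro integrable_mult_right integrable_cis_circle)
  have summ: "summable (\<lambda>k. \<integral>t. norm (of_real (a k) * cis (b k * t)) \<partial>circle_measure)" for b :: "nat \<Rightarrow> real"
    using a by (simp add: norm_mult summable_mult)
  have AE: "AE t in circle_measure. summable (\<lambda>k. norm (of_real (a k) * cis (b k * t)))" for b :: "nat \<Rightarrow> real"
    using a by (simp add: norm_mult)
  have "integrable circle_measure (\<lambda>t. \<Sum>k. of_real (a k) * cis (- real (n k) * t))"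
    by (rule integrable_suminf[OF int AE summ])
  then have integrable: "integrable circle_measure (lacunary a n)"
    by (simp add: lacunary_def[abs_def])
  have coeff: "fourier_coeff (lacunary a n) m = (\<Sum>k. of_real (a k) * (if - int (n k) = m then 1 else 0))" for m
  proof -
    have "lacunary a n t * cis (- (of_int m * t)) = (\<Sum>k. of_real (a k) * cis (of_int (- int (n k) - m) * t))" for t
    proof -
      have "(\<Sum>k. of_real (a k) * cis (of_int (- int (n k) - m) * t)) =
          (\<Sum>k. of_real (a k) * cis (- (real (n k) * t)) * cis (- (of_int m * t)))"
      proof -
        have "cis (of_int (- int (n k) - m) * t) = cis (- (real (n k) * t)) * cis (- (of_int m * t))" for k
          unfolding cis_mult by (intro arg_cong[of _ _ cis]) (simp add: algebra_simps)
        then show ?thesis by (simp only: mult.assoc)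
      qed
      then show ?thesis
        unfolding lacunary_def by (simp only: suminf_mult2[OF summable_lacunary[OF a]])
    qed
    then have "integral\<^sup>L circle_measure (\<lambda>t. lacunary a n t * cis (- (of_int m * t))) =
        (\<Sum>k. integral\<^sup>L circle_measure (\<lambda>t. of_real (a k) * cis (of_int (- int (n k) - m) * t)))"
      by (simp only: integral_suminf[OF int AE summ])
    also have "\<dots> = (\<Sum>k. of_real (2*pi) * (of_real (a k) * (if - int (n k) = m then 1 else 0)))"
      using integral_cis_circle[of "- int (n _) - m"] by (intro arg_cong[of _ _ suminf] ext) simp
    also have "\<dots> = of_real (2*pi) * (\<Sum>k. of_real (a k) * (if - int (n k) = m then 1 else 0))"
    proof (rule suminf_mult)
      show "summable (\<lambda>k. complex_of_real (a k) * (if - int (n k) = m then 1 else 0))"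
        by (rule summable_comparison_test'[OF a(1), of 0]) (use a in \<open>auto simp: norm_mult\<close>)
    qed
    finally show ?thesis by (simp add: fourier_coeff_def)
  qed
  define \<phi> where "\<phi> k = - int (n k)" for k
  have inj: "inj \<phi>" using n by (auto simp: \<phi>_def inj_def)
  have on: "fourier_coeff (lacunary a n) (\<phi> k) = of_real (a k)" for k
  proof -
    have "(\<lambda>j. complex_of_real (a j) * (if - int (n j) = \<phi> k then 1 else 0)) = (\<lambda>j. if j = k then of_real (a j) else 0)"
      using n by (auto simp: \<phi>_def inj_def)
    then show ?thesis unfolding coeff using sums_single[of k "\<lambda>j. complex_of_real (a j)"] by (simp add: sums_iff)
  qed
  have off: "fourier_coeff (lacunary a n) m = 0" if "m \<notin> range \<phi>" for m
  proof -
    have "- int (n j) \<noteq> m" for j using that by (auto simp: \<phi>_def)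
    then show ?thesis unfolding coeff by simp
  qed
  have "(\<lambda>k. norm (fourier_coeff (lacunary a n) (\<phi> k))) summable_on UNIV"
    using a by (intro norm_summable_imp_summable_on) (simp add: on)
  then have "(\<lambda>m. norm (fourier_coeff (lacunary a n) m)) summable_on range \<phi>"
    using summable_on_reindex[OF inj, of "\<lambda>m. norm (fourier_coeff (lacunary a n) m)"] by (simp add: o_def)
  moreover have "(\<lambda>m. norm (fourier_coeff (lacunary a n) m)) summable_on range \<phi> \<longleftrightarrow>
      (\<lambda>m. norm (fourier_coeff (lacunary a n) m)) summable_on UNIV"
    by (rule summable_on_cong_neutral) (use off in auto)
  ultimately have "(\<lambda>m. norm (fourier_coeff (lacunary a n) m)) summable_on UNIV"
    by simp
  with integrable show ?thesis by (simp add: wiener_algebra_def)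
qed

text \<open>A shift by half a period flips the sign of term \<open>k\<close>. Earlier terms
  oscillate slowly and change by at most their Lipschitz constant times \<open>s\<close>; later
  terms are bounded by the tail of \<open>a\<close>.\<close>

lemma lacunary_half_period_shift:
  assumes a: "summable a" "\<And>k. 0 \<le> a k" and s: "0 \<le> s" "real (n k) * s = pi"
  shows "norm (lacunary a n (t + s) - lacunary a n t + of_real (2 * a k) * cis (- (real (n k) * t)))
    \<le> (\<Sum>j<k. a j * real (n j)) * s + 2 * (\<Sum>j. a (j + Suc k))"
proof -
  define d where "d j = complex_of_real (a j) * (cis (- (real (n j) * (t + s))) - cis (- (real (n j) * t)))" for j
  have norm_d: "norm (d j) \<le> 2 * a j" for j
  proof -
    have "norm (cis (- (real (n j) * (t + s))) - cis (- (real (n j) * t))) \<le> 2"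
      by (rule order_trans[OF norm_triangle_ineq4]) simp
    from mult_left_mono[OF this a(2)[of j]] show ?thesis using a(2)[of j] by (simp add: d_def norm_mult)
  qed
  have sd: "summable d"
    by (rule summable_comparison_test'[OF summable_mult[OF a(1), of 2], of 0]) (use norm_d in auto)
  have "lacunary a n (t + s) - lacunary a n t = suminf d"
    unfolding lacunary_def d_def right_diff_distrib
    by (intro suminf_diff[OF summable_lacunary[OF a] summable_lacunary[OF a]])
  also have "suminf d = (\<Sum>j. d (j + Suc k)) + (\<Sum>j<k. d j) + d k"
    using suminf_split_initial_segment[OF sd, of "Suc k"] by simp
  also have "d k = - of_real (2 * a k) * cis (- (real (n k) * t))"
  proof -
    have "cis (- (real (n k) * (t + s))) = cis (- (real (n k) * t)) * cis (- pi)"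
      using s(2) by (simp add: cis_mult algebra_simps)
    also have "cis (- pi) = -1" by (simp add: complex_eq_iff)
    finally show ?thesis by (simp add: d_def)
  qed
  finally have "lacunary a n (t + s) - lacunary a n t + of_real (2 * a k) * cis (- (real (n k) * t)) =
      (\<Sum>j<k. d j) + (\<Sum>j. d (j + Suc k))" by simp
  also have "norm \<dots> \<le> (\<Sum>j<k. a j * real (n j)) * s + 2 * (\<Sum>j. a (j + Suc k))"
  proof (intro order_trans[OF norm_triangle_ineq] add_mono)
    have "norm (\<Sum>j<k. d j) \<le> (\<Sum>j<k. a j * real (n j) * s)"
    proof (rule sum_norm_le)
      fix j
      have "norm (cis (- (real (n j) * (t + s))) - cis (- (real (n j) * t))) \<le> real (n j) * s"
        using norm_cis_diff_le[of "- (real (n j) * (t + s))" "- (real (n j) * t)"] s(1)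
        by (simp add: algebra_simps)
      from mult_left_mono[OF this a(2)[of j]] show "norm (d j) \<le> a j * real (n j) * s"
        using a(2)[of j] by (simp add: d_def norm_mult mult.assoc)
    qed
    then show "norm (\<Sum>j<k. d j) \<le> (\<Sum>j<k. a j * real (n j)) * s" by (simp add: sum_distrib_right)
    have sa: "summable (\<lambda>j. a (j + Suc k))" by (rule summable_ignore_initial_segment[OF a(1)])
    have "norm (\<Sum>j. d (j + Suc k)) \<le> (\<Sum>j. 2 * a (j + Suc k))"
      by (rule norm_suminf_le[OF norm_d summable_mult[OF sa]])
    also have "\<dots> = 2 * (\<Sum>j. a (j + Suc k))" by (rule suminf_mult[OF sa])
    finally show "norm (\<Sum>j. d (j + Suc k)) \<le> 2 * (\<Sum>j. a (j + Suc k))" .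
  qed
  finally show ?thesis .
qed

text \<open>The amplitudes decrease so fast that the tail after \<open>k\<close> is negligible against \<open>tol k\<close>, while
  \<open>sqrt (tol k)\<close> is still only slightly smaller than \<open>amp k\<close>.\<close>

definition amp :: "nat \<Rightarrow> real" where "amp k = (1/2) ^ (3 ^ k)"

definition tol :: "nat \<Rightarrow> real" where "tol k = (amp k / (real k + 1))\<^sup>2"

lemma less_power_three: "k < 3 ^ k"
  by (induction k) auto

lemma amp_pos: "0 < amp k"
  by (simp add: amp_def)

lemma amp_le: "amp k \<le> (1/2) ^ Suc k"
  unfolding amp_def using less_power_three[of k] by (intro power_decreasing) auto

lemma amp_le_1: "amp k \<le> 1"
  unfolding amp_def by (intro power_le_one) auto

lemma tol_pos: "0 < tol k"
  using amp_pos[of k] by (simp add: tol_def)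

lemma tol_le_1: "tol k \<le> 1"
  unfolding tol_def using amp_le_1[of k] amp_pos[of k] by (intro power_le_one) auto

text \<open>The quotient of \<open>amp k\<close> and \<open>sqrt (tol k)\<close> is unbounded in
  \<open>k\<close>, which is what the two-constants bound contradicts.\<close>

lemma sqrt_tol: "sqrt (tol k) = amp k / (real k + 1)"
  unfolding tol_def using amp_pos[of k] by (simp add: less_imp_le)

lemma sums_geometric_half: "(\<lambda>j. C * (1/2) ^ j) sums (2 * C :: real)"
  using sums_mult[OF geometric_sums[of "1/2 :: real"], of C] by (simp add: mult.commute)

lemma summable_amp: "summable amp"
proof (rule summable_comparison_test'[OF sums_summable[OF sums_geometric_half[of "1/2"]], of 0])
  show "norm (amp k) \<le> 1/2 * (1/2) ^ k" for k
    using amp_le[of k] amp_pos[of k] by simp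
qed

lemma sum_amp_le: "(\<Sum>j<k. amp j) \<le> 1"
proof -
  have "(\<Sum>j<k. amp j) \<le> (\<Sum>j. amp j)"
    by (rule sum_le_suminf[OF summable_amp]) (auto intro: less_imp_le[OF amp_pos])
  also have "\<dots> \<le> (\<Sum>j. 1/2 * (1/2) ^ j)"
    by (rule suminf_le[OF _ summable_amp sums_summable[OF sums_geometric_half[of "1/2"]]])
      (use amp_le in simp)
  also have "\<dots> = 1" using sums_geometric_half[of "1/2"] by (simp add: sums_iff)
  finally show ?thesis .
qed

text \<open>Since the exponent triples at each step, \<open>amp (Suc k) = amp k ^ 3\<close>, and
  from there on the terms are dominated by a geometric series of ratio 1/2.\<close>

lemma suminf_amp_tail: "(\<Sum>j. amp (j + Suc k)) \<le> 2 * amp k ^ 3"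
proof -
  have "amp (j + Suc k) \<le> amp k ^ 3 * (1/2) ^ j" for j
  proof -
    have "3 ^ Suc k + j \<le> (3::nat) ^ (j + Suc k)"
    proof (induction j)
      case (Suc j)
      have "1 \<le> (3::nat) ^ (j + Suc k)" "(3::nat) ^ (Suc j + Suc k) = 3 * 3 ^ (j + Suc k)" by simp_all
      with Suc show ?case by linarith
    qed simp
    then have "amp (j + Suc k) \<le> (1/2) ^ (3 ^ Suc k + j)"
      unfolding amp_def by (intro power_decreasing) auto
    also have "\<dots> = amp k ^ 3 * (1/2) ^ j"
      by (simp add: amp_def power_add power_mult[symmetric] mult.commute)
    finally show ?thesis .
  qed
  then have "(\<Sum>j. amp (j + Suc k)) \<le> (\<Sum>j. amp k ^ 3 * (1/2) ^ j)"
    using summable_ignore_initial_segment[OF summable_amp, of "Suc k"] sums_summable[OF sums_geometric_half[of "amp k ^ 3"]]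
    by (intro suminf_le) auto
  also have "\<dots> = 2 * amp k ^ 3" using sums_geometric_half[of "amp k ^ 3"] by (simp add: sums_iff)
  finally show ?thesis .
qed

text \<open>The tail is of order \<open>amp k ^ 3\<close> while \<open>tol k\<close> loses only a
  factor \<open>(real k + 1)\<^sup>2\<close> against \<open>(amp k)\<^sup>2\<close>; the spare
  factor \<open>amp k\<close> wins. The 64 is 4 from the doubled tail bound times 16.\<close>

lemma eventually_tail_le_tol: "\<forall>\<^sub>F k in sequentially. 2 * (\<Sum>j. amp (j + Suc k)) \<le> tol k / 16"
proof -
  have "\<forall>\<^sub>F k in sequentially. (1/2::real) ^ Suc k * (64 * (real k + 1)\<^sup>2) \<le> 1"
    by real_asymp
  then show ?thesis
  proof eventually_elim
    case (elim k)
    define D where "D = (real k + 1)\<^sup>2"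
    have D: "0 < D" by (simp add: D_def)
    have "amp k * (64 * D) \<le> 1"
      using D by (intro order_trans[OF mult_right_mono[OF amp_le] elim[folded D_def]]) simp
    then have "(amp k)\<^sup>2 * (amp k * (64 * D)) \<le> (amp k)\<^sup>2 * 1"
      by (intro mult_left_mono) auto
    then have "4 * amp k ^ 3 * (16 * D) \<le> (amp k)\<^sup>2"
      by (simp add: power2_eq_square power3_eq_cube mult_ac)
    then have "4 * amp k ^ 3 \<le> (amp k)\<^sup>2 / (16 * D)"
      using D by (subst pos_le_divide_eq) auto
    then have "4 * amp k ^ 3 \<le> tol k / 16"
      by (simp add: tol_def power_divide D_def mult.commute)
    then show ?case using suminf_amp_tail[of k] by simp
  qed
qed

section \<open>Choice of frequencies and the contradiction\<close>

text \<open>Running products of integers \<open>b k\<close> above \<open>R k\<close>: the last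
  factor alone gives both lower bounds, and factors of at least 2 give strict growth.\<close>

lemma exists_rapid_frequencies:
  fixes R :: "nat \<Rightarrow> real"
  obtains n :: "nat \<Rightarrow> nat" where "strict_mono n" "\<And>k. R k \<le> real (n k)"
    "\<And>j k. j < k \<Longrightarrow> R k * real (n j) \<le> real (n k)"
proof -
  define b where "b k = nat \<lceil>max (R k) 2\<rceil>" for k
  define n where "n k = (\<Prod>i\<le>k. b i)" for k
  have b: "R k \<le> real (b k)" "2 \<le> b k" for k
    unfolding b_def by linarith+
  have n_Suc: "n (Suc k) = n k * b (Suc k)" for k by (simp add: n_def)
  have n_pos: "0 < n k" for k
    unfolding n_def using b(2) by (intro prod_pos) (simp add: less_le_trans[of 0 2])
  have mono: "strict_mono n"
  proof (rule strict_mono_Suc_iff[THEN iffD2], rule allI)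
    fix k
    have "n k * 1 < n k * b (Suc k)"
      using n_pos[of k] b(2)[of "Suc k"] by (intro mult_strict_left_mono) auto
    then show "n k < n (Suc k)" by (simp add: n_Suc)
  qed
  show thesis
  proof
    show "strict_mono n" by (fact mono)
    have "b k \<le> n k" for k
    proof (cases k)
      case (Suc i)
      then show ?thesis using n_pos[of i] by (simp add: n_Suc)
    qed (simp add: n_def)
    then show "R k \<le> real (n k)" for k
      using b(1)[of k] by (meson of_nat_le_iff order_trans)
    show "R k * real (n j) \<le> real (n k)" if jk: "j < k" for j k
    proof -
      obtain i where k: "k = Suc i" "j \<le> i" using jk by (cases k) auto
      have "n j \<le> n i" using k(2) mono by (simp add: strict_mono_less_eq)
      then have "R k * real (n j) \<le> real (b k) * real (n i)"
        using b(1)[of k] by (intro mult_mono) auto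
      then show ?thesis by (simp add: k(1) n_Suc mult.commute)
    qed
  qed
qed

lemma norm_fourier_coeff_le:
  "norm (fourier_coeff h n) \<le> 1 / (2*pi) * (\<integral>t. norm (h t) \<partial>circle_measure)"
proof -
  have "norm (fourier_coeff h n) = 1 / (2*pi) * norm (\<integral>t. h t * cis (- (of_int n * t)) \<partial>circle_measure)"
    by (simp add: fourier_coeff_def norm_mult norm_divide)
  also have "\<dots> \<le> 1 / (2*pi) * (\<integral>t. norm (h t * cis (- (of_int n * t))) \<partial>circle_measure)"
    by (intro mult_left_mono integral_norm_bound) auto
  finally show ?thesis by (simp add: norm_mult)
qed

theorem theorem1:
  fixes \<omega> :: "nat \<Rightarrow> real"
  assumes "\<And>n. 0 < \<omega> n"
    and "mono \<omega>"
    and "filterlim \<omega> at_top sequentially"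
  shows "\<exists>f \<in> wiener_algebra. \<not> (\<exists>g h. g \<in> PLA \<and> h \<in> H_omega \<omega> \<and>
            (AE t in circle_measure. f t = g t + h t))"
proof -
  have "\<exists>i. (real k + 1) / tol k \<le> \<omega> i" for k
    using assms(3) unfolding filterlim_at_top by (meson eventually_happens' sequentially_bot)
  \<comment> \<open>Cutoff frequency beyond which the weight makes the remainder of any
    \<open>h\<close> in the space small at scale \<open>tol k\<close>, once \<open>k\<close> is
    large for that \<open>h\<close>.\<close>
  then obtain K where K: "\<And>k. (real k + 1) / tol k \<le> \<omega> (K k)" by metis
  \<comment> \<open>The product \<open>(2 K + 1) K\<close> is the Lipschitz factor of a partial sum
    of \<open>h\<close>, and the 1 serves the earlier lacunary terms. With
    \<open>s \<le> pi / R k\<close> both contributions become multiples of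
    \<open>tol k / (real k + 1)\<close>. Only \<open>\<omega>\<close> enters, so \<open>f\<close> is
    fixed before \<open>g\<close> and \<open>h\<close>; their constants are later absorbed by
    \<open>real k + 1\<close>.\<close>
  define R where "R k = (real k + 1) * (real (2 * K k + 1) * real (K k) + 1) / tol k" for k
  have R_ge: "(real k + 1) * x / tol k \<le> R k" if "x \<le> real (2 * K k + 1) * real (K k) + 1" for k x
    unfolding R_def using that tol_pos[of k] by (intro divide_right_mono mult_left_mono) auto
  have R_ge': "real k + 1 \<le> R k" for k
  proof -
    have "(real k + 1) * tol k \<le> (real k + 1) * 1" using tol_le_1 by (intro mult_left_mono) auto
    then have "real k + 1 \<le> (real k + 1) * 1 / tol k" using tol_pos[of k] by (simp add: pos_le_divide_eq)
    also have "\<dots> \<le> R k" by (rule R_ge) simp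
    finally show ?thesis .
  qed
  have R_pos: "0 < R k" for k using R_ge'[of k] by linarith
  obtain n where n: "strict_mono n" and nR: "\<And>k. R k \<le> real (n k)"
    and nn: "\<And>j k. j < k \<Longrightarrow> R k * real (n j) \<le> real (n k)"
    using exists_rapid_frequencies[of R] by blast
  define f where "f = lacunary amp n"
  have "f \<in> wiener_algebra"
    unfolding f_def using n by (intro lacunary_in_wiener_algebra summable_amp less_imp_le[OF amp_pos] strict_mono_imp_inj_on)
  moreover have False if "g \<in> PLA" and h: "h \<in> H_omega \<omega>" and fgh: "AE t in circle_measure. f t = g t + h t" for g h
  proof -
    obtain c where "AE t in circle_measure. (\<lambda>N. \<Sum>n<N. c n * cis (real n * t)) \<longlonglongrightarrow> g t"
      using \<open>g \<in> PLA\<close> unfolding PLA_def by blast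
    define S where "S N t = (\<Sum>n<N. c n * cis (real n * t))" for N t
    have "AE t in circle_measure. (\<lambda>N. S N t) \<longlonglongrightarrow> f t - h t"
      using \<open>AE t in circle_measure. (\<lambda>N. \<Sum>n<N. c n * cis (real n * t)) \<longlonglongrightarrow> g t\<close> fgh
      by eventually_elim (simp add: S_def)
    then obtain Z where Z: "{t \<in> space circle_measure. \<not> (\<lambda>N. S N t) \<longlonglongrightarrow> f t - h t} \<subseteq> Z"
      "emeasure circle_measure Z = 0" "Z \<in> sets circle_measure"
      by (rule AE_E)
    have Sm [measurable]: "S N \<in> borel_measurable circle_measure" for N
      unfolding S_def by (intro borel_measurable_circle_continuous continuous_intros)
    \<comment> \<open>Convergent sequences are bounded, so some level \<open>M\<close> bounds all
      partial sums off a small set. It is fixed before \<open>k\<close>.\<close>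
    define A where "A m = {t \<in> space circle_measure. \<exists>N. real m < norm (S N t)}" for m
    have A: "A m \<in> sets circle_measure" for m unfolding A_def by measurable
    have "decseq A" unfolding A_def decseq_def by (auto intro: le_less_trans of_nat_mono)
    moreover have "AE t in circle_measure. \<exists>m. t \<notin> A m"
      using \<open>AE t in circle_measure. (\<lambda>N. S N t) \<longlonglongrightarrow> f t - h t\<close>
    proof eventually_elim
      case (elim t)
      then have "Bseq (\<lambda>N. S N t)" by (intro convergent_imp_Bseq convergentI)
      then obtain B where "\<And>N. norm (S N t) \<le> B" unfolding Bseq_def by blast
      then have "t \<notin> A (nat \<lceil>B\<rceil>)" unfolding A_def by (auto simp: not_less intro: order_trans real_nat_ceiling_ge)
      then show ?case ..
    qed
    ultimately obtain M where M: "1 \<le> M" "measure circle_measure (A M) < 1/100"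
      using small_measure_of_AE_decreasing[of A "1/100" 1] A by auto
    have h2: "h \<in> borel_measurable circle_measure" "integrable circle_measure (\<lambda>t. (norm (h t))\<^sup>2)"
      and hs: "(\<lambda>n::int. (norm (fourier_coeff h n))\<^sup>2 * (\<omega> (nat \<bar>n\<bar>))\<^sup>2) summable_on UNIV"
      using h unfolding H_omega_def by auto
    define W where "W = (\<Sum>\<^sub>\<infinity>n::int. (norm (fourier_coeff h n))\<^sup>2 * (\<omega> (nat \<bar>n\<bar>))\<^sup>2)"
    have W: "(\<Sum>n\<in>I. (norm (fourier_coeff h n))\<^sup>2 * (\<omega> (nat \<bar>n\<bar>))\<^sup>2) \<le> W" if "finite I" for I
      unfolding W_def by (rule finite_sum_le_infsum[OF hs that]) auto
    have W0: "0 \<le> W" using W[of "{}"] by simp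
    define C where "C = 1 / (2*pi) * (\<integral>t. norm (h t) \<partial>circle_measure)"
    have C0: "0 \<le> C" unfolding C_def by (intro mult_nonneg_nonneg integral_nonneg_AE) auto
    have Ch: "norm (fourier_coeff h n) \<le> C" for n unfolding C_def by (rule norm_fourier_coeff_le)
    \<comment> \<open>In order: earlier lacunary terms, partial sum of \<open>h\<close>, measure of
      \<open>Q\<close> (with 51200 = 2 * 256 * 100), shift at most 1/50, final contradiction,
      lacunary tail.\<close>
    have "\<forall>\<^sub>F k in sequentially. 16 * pi \<le> real k + 1 \<and> 16 * pi * C \<le> real k + 1 \<and> 51200 * pi * W \<le> real k + 1 \<and>
        50 * pi \<le> real k + 1 \<and> 3 * (1 + real M) < real k + 1 \<and> 2 * (\<Sum>j. amp (j + Suc k)) \<le> tol k / 16"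
      by (intro eventually_conj eventually_tail_le_tol) real_asymp+
    then obtain k where k: "16 * pi \<le> real k + 1" "16 * pi * C \<le> real k + 1" "51200 * pi * W \<le> real k + 1"
        "50 * pi \<le> real k + 1" "3 * (1 + real M) < real k + 1" "2 * (\<Sum>j. amp (j + Suc k)) \<le> tol k / 16"
      by (auto dest!: eventually_happens'[OF sequentially_bot])
    define s where "s = pi / real (n k)"
    have nk: "0 < real (n k)" using nR[of k] R_pos[of k] by linarith
    have s: "0 \<le> s" "real (n k) * s = pi" "s \<le> pi / R k"
      using nk nR[of k] R_pos[of k] by (auto simp: s_def intro!: divide_left_mono mult_pos_pos)
    have "s \<le> 1/50"
    proof -
      have "50 * pi \<le> real (n k)" using k(4) R_ge'[of k] nR[of k] by linarith
      then show ?thesis using nk by (simp add: s_def field_simps)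
    qed
    have \<tau>: "0 < tol k" "tol k \<le> 1" by (rule tol_pos tol_le_1)+
    define r where "r t = h t - fourier_partial h (K k) t" for t
    define Q where "Q = {t \<in> space circle_measure. tol k / 16 \<le> norm (r t)}"
    have Pm [measurable]: "fourier_partial h (K k) \<in> borel_measurable circle_measure"
      by (intro borel_measurable_circle_continuous continuous_intros)
    have Q: "Q \<in> sets circle_measure"
      unfolding Q_def r_def using h2(1) by measurable
    have Qle: "measure circle_measure Q \<le> 1/100"
    proof -
      have "measure circle_measure Q \<le> 2*pi * W / ((\<omega> (K k))\<^sup>2 * (tol k / 16)\<^sup>2)"
        unfolding Q_def r_def using \<tau> by (intro fourier_remainder_measure h2 W assms) auto
      also have "\<dots> \<le> 2*pi * W / ((real k + 1) / 256)"
      proof (rule divide_left_mono)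
        have "real k + 1 \<le> (real k + 1)\<^sup>2" by (simp add: power2_eq_square)
        also have "\<dots> \<le> (\<omega> (K k) * tol k)\<^sup>2"
          using K[of k] \<tau> by (intro power_mono) (auto simp: pos_divide_le_eq)
        finally show "(real k + 1) / 256 \<le> (\<omega> (K k))\<^sup>2 * (tol k / 16)\<^sup>2"
          by (simp add: power_mult_distrib power_divide)
        then show "0 < (\<omega> (K k))\<^sup>2 * (tol k / 16)\<^sup>2 * ((real k + 1) / 256)"
          by (intro mult_pos_pos) (auto simp: \<tau> assms(1) intro!: zero_less_power)
      qed (use W0 in auto)
      also have "\<dots> \<le> 1/100" using k(3) by (simp add: pos_divide_le_eq)
      finally show ?thesis .
    qed
    define X where "X = A M \<union> Z \<union> Q"
    have Xc: "X \<in> sets circle_measure" unfolding X_def using A Z Q by auto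
    then have X: "X \<in> sets lebesgue" "X \<subseteq> {0..2*pi}" by (auto simp: sets_circle_measure_iff)
    have "measure circle_measure X \<le> measure circle_measure (A M) + measure circle_measure Z + measure circle_measure Q"
      unfolding X_def using A Z Q by (intro order_trans[OF measure_Un_le] add_mono) auto
    moreover have "measure circle_measure Z = 0" using Z(2) by (simp add: measure_def)
    ultimately have Xle: "measure lebesgue X \<le> 1/50"
      using M(2) Qle by (simp add: measure_circle_measure[OF X(2)])
    have lim: "(\<lambda>N. S N t) \<longlonglongrightarrow> f t - h t" if "t \<in> {0..2*pi} - X" for t
      using Z(1) that unfolding X_def by auto
    have bounded: "norm (S N t) \<le> real M" if "t \<in> {0..2*pi} - X" for N t
      using that unfolding X_def A_def by (auto simp: not_less)
    \<comment> \<open>Five errors of at most \<open>tol k / 16\<close>: earlier lacunary terms,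
      lacunary tail, shifted partial sum of \<open>h\<close>, and its remainder at
      \<open>t + s\<close> and at \<open>t\<close>. Their sum is below
      \<open>tol k / 2\<close>.\<close>
    have close: "norm ((f (t + s) - h (t + s)) - (f t - h t) + of_real (2 * amp k) * cis (- (real (n k) * t))) \<le> tol k / 2"
      if t: "t \<in> {0..2*pi} - X" "t + s \<in> {0..2*pi} - X" for t
    proof -
      let ?F = "f (t + s) - f t + of_real (2 * amp k) * cis (- (real (n k) * t))"
      let ?P = "fourier_partial h (K k) (t + s) - fourier_partial h (K k) t"
      have "norm ?F \<le> (\<Sum>j<k. amp j * real (n j)) * s + 2 * (\<Sum>j. amp (j + Suc k))"
        unfolding f_def by (intro lacunary_half_period_shift summable_amp less_imp_le[OF amp_pos] s)
      moreover have "(\<Sum>j<k. amp j * real (n j)) * s \<le> tol k / 16"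
      proof -
        have "(\<Sum>j<k. amp j * real (n j)) \<le> (\<Sum>j<k. amp j * (real (n k) / R k))"
          using nn R_pos[of k]
          by (intro sum_mono mult_left_mono) (auto simp: pos_le_divide_eq mult.commute less_imp_le[OF amp_pos])
        also have "\<dots> \<le> 1 * (real (n k) / R k)"
          unfolding sum_distrib_right[symmetric] using R_pos[of k] by (intro mult_right_mono sum_amp_le) simp
        finally have "(\<Sum>j<k. amp j * real (n j)) * s \<le> (real (n k) / R k) * s"
          using s(1) by (intro mult_right_mono) auto
        also have "\<dots> = pi / R k" using s(2) by simp
        also have "\<dots> \<le> pi / ((real k + 1) / tol k)"
          using R_ge[of 1 k] \<tau> R_pos[of k] by (intro divide_left_mono mult_pos_pos) auto
        also have "\<dots> \<le> tol k / 16"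
          using mult_right_mono[OF k(1), of "tol k"] \<tau> by (simp add: field_simps)
        finally show ?thesis .
      qed
      moreover have "norm ?P \<le> tol k / 16"
      proof -
        have "norm ?P \<le> real (2 * K k + 1) * (C * (real (K k) * s))"
          by (rule fourier_partial_shift[OF Ch s(1)])
        also have "\<dots> = C * ((real (2 * K k + 1) * real (K k)) * s)" by (simp only: mult_ac)
        also have "\<dots> \<le> C * ((R k * tol k / (real k + 1)) * (pi / R k))"
        proof (intro mult_left_mono mult_mono s C0)
          show "real (2 * K k + 1) * real (K k) \<le> R k * tol k / (real k + 1)"
            using \<tau> by (simp add: R_def)
        qed (use R_pos[of k] \<tau> in auto)
        also have "\<dots> = (pi * C) * tol k / (real k + 1)" using R_pos[of k] by (simp add: field_simps)
        also have "\<dots> \<le> tol k / 16"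
          using mult_right_mono[OF k(2), of "tol k"] \<tau> by (simp add: field_simps)
        finally show ?thesis .
      qed
      moreover have "norm (r (t + s)) \<le> tol k / 16" "norm (r t) \<le> tol k / 16"
        using t unfolding X_def Q_def by auto
      moreover have eq: "(f (t + s) - h (t + s)) - (f t - h t) + of_real (2 * amp k) * cis (- (real (n k) * t)) =
          ?F - ?P - r (t + s) + r t"
        by (simp add: r_def)
      moreover have "norm (?F - ?P - r (t + s) + r t) \<le> norm ?F + norm ?P + norm (r (t + s)) + norm (r t)"
        by (rule order_trans[OF norm_triangle_ineq] add_mono order_trans[OF norm_triangle_ineq4] order_refl)+
      ultimately show ?thesis unfolding eq using k(6) \<tau>(1) by linarith
    qed
    \<comment> \<open>After inserting \<open>sqrt_tol\<close> the amplitude cancels, leaving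
      \<open>real k + 1 \<le> 3 * (1 + real M)\<close>, against the choice of
      \<open>k\<close>.\<close>
    have "2 * amp k \<le> 3 * (2 + 2 * real M) * sqrt (tol k)"
      by (rule amplitude_bound[OF S_def X Xle bounded lim s(1) \<open>s \<le> 1/50\<close> close])
        (use nk M \<tau> amp_le_1 less_imp_le[OF amp_pos] in auto)
    then have "(real k + 1) * amp k \<le> (3 * (1 + real M)) * amp k"
      unfolding sqrt_tol by (simp add: field_simps)
    then show False using k(5) amp_pos[of k] by (simp add: mult_le_cancel_right)
  qed
  ultimately show ?thesis by blast
qed

end
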